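(* The skyscraper sheaves over a complex analytic manifold do not admit holomorphic connections. That is, for a complex analytic manifold $X$ and a point $p\in X$, the skyscraper sheaf ${\mathscr S}$ on $X$ at $p$ with stalk ${\mathbb C}$ admits no holomorphic connection.
   Context: ${\mathscr O}$ is the sheaf of holomorphic functions on $X$, $\Omega^1$ the sheaf of holomorphic $1$-forms. With $P=\{p\}$, $i:P\to X$ the inclusion and ${\mathscr O}_P(P)={\mathbb C}$, the skyscraper sheaf is ${\mathscr S}:=i_*{\mathscr O}_P$, an ${\mathscr O}$-module via evaluation at $p$; it is coherent. For a coherent ${\mathscr O}$-module ${\mathscr F}$, let ${\mathscr J}^1({\mathscr F})={\mathscr O}_{X^{(1)}}\otimes_{\mathscr O}{\mathscr F}$, where $X^{(1)}$ is the first infinitesimal neighborhood of the diagonal of $X\times X$; there is an exact sequence of ${\mathscr O}$-modules $0\to\Omega^1\otimes_{\mathscr O}{\mathscr F}\to{\mathscr J}^1({\mathscr F})\overset{\pi}{\to}{\mathscr F}\to0$. A holomorphic connection on ${\mathscr F}$ is a right inverse of $\pi$ (as ${\mathscr O}$-modules); it gives a morphism of ${\mathbb C}_X$-modules $\nabla:{\mathscr F}\to\Omega^1\otimes_{\mathscr O}{\mathscr F}$ with $\nabla(f\sigma)=df\otimes\sigma+f\nabla\sigma$ for holomorphic functions $f$ and sections $\sigma$ of ${\mathscr F}$.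
   Formalization: The complex analytic manifold X is taken of (pure) dimension at least one; if X has dimension zero, then Ω^1 = 0, J^1(S) = S and the identity is a holomorphic connection, so the claim fails there. *)

theory Defs
  imports "HOL-Analysis.Analysis" "HOL-Algebra.Module" "HOL-Algebra.Ideal_Product"
    "HOL-Algebra.QuotRing" "HOL-Algebra.Generated_Groups" "HOL-Algebra.Free_Abelian_Groups"
begin

section \<open>Complex manifolds\<close>

type_synonym ('a, 'n) chart = "'a set \<times> ('a \<Rightarrow> complex ^ 'n)"

text \<open>Holomorphy in several variables is Frechet differentiability with a complex-linear
  derivative.  It is used on open sets only.\<close>

definition holomorphic_many :: "(complex ^ 'n \<Rightarrow> complex) \<Rightarrow> (complex ^ 'n) set \<Rightarrow> bool" where
  "holomorphic_many f S \<longleftrightarrow>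
     (\<forall>z\<in>S. \<exists>D. (f has_derivative D) (at z) \<and> (\<forall>c v. D (c *s v) = c * D v))"

definition complex_atlas :: "'a topology \<Rightarrow> ('a, 'n::finite) chart set \<Rightarrow> bool" where
  "complex_atlas X A \<longleftrightarrow>
     (\<forall>(U, \<phi>)\<in>A. openin X U \<and> open (\<phi> ` U) \<and>
        homeomorphic_map (subtopology X U) (top_of_set (\<phi> ` U)) \<phi>) \<and>
     (\<Union>(U, \<phi>)\<in>A. U) = topspace X \<and>
     (\<forall>(U, \<phi>)\<in>A. \<forall>(V, \<psi>)\<in>A. \<forall>i.
        holomorphic_many (\<lambda>z. \<psi> (inv_into U \<phi> z) $ i) (\<phi> ` (U \<inter> V)))"

text \<open>The dimension is \<open>CARD('n)\<close>, hence at least one.\<close>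

definition complex_manifold :: "'a topology \<Rightarrow> ('a, 'n::finite) chart set \<Rightarrow> bool" where
  "complex_manifold X A \<longleftrightarrow>
     Hausdorff_space X \<and> second_countable X \<and> complex_atlas X A"

definition prod_chart ::
  "('a, 'n::finite) chart \<Rightarrow> ('b, 'm::finite) chart \<Rightarrow> ('a \<times> 'b, 'n + 'm) chart" where
  "prod_chart = (\<lambda>(U, \<phi>) (V, \<psi>).
     (U \<times> V, \<lambda>(x, y). \<chi> i. case i of Inl j \<Rightarrow> \<phi> x $ j | Inr k \<Rightarrow> \<psi> y $ k))"

definition prod_atlas ::
  "('a, 'n::finite) chart set \<Rightarrow> ('b, 'm::finite) chart set \<Rightarrow> ('a \<times> 'b, 'n + 'm) chart set" where
  "prod_atlas A B = {prod_chart c d | c d. c \<in> A \<and> d \<in> B}"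


section \<open>Presheaves, stalks and sheafification\<close>

text \<open>The sections over an open set form an algebraic structure of type \<open>'k\<close> (a ring or a
  module record) with elements of type \<open>'s\<close>.  Only the values on open sets are relevant.\<close>

record ('a, 's, 'k) presheaf =
  sect :: "'a set \<Rightarrow> 'k"
  restr :: "'a set \<Rightarrow> 'a set \<Rightarrow> 's \<Rightarrow> 's"

type_synonym ('a, 's) ring_presheaf = "('a, 's, 's ring) presheaf"

type_synonym ('a, 'r, 's) module_presheaf = "('a, 's, ('r, 's) module) presheaf"

type_synonym ('a, 's) germ = "('a set \<times> 's) set"

definition germ ::
  "'a topology \<Rightarrow> ('a, 's, ('s, 'e) ring_scheme) presheaf \<Rightarrow> 'a \<Rightarrow> 'a set \<Rightarrow> 's \<Rightarrow> ('a, 's) germ" where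
  "germ X F x U s = {(V, t). openin X V \<and> x \<in> V \<and> t \<in> carrier (sect F V) \<and>
     (\<exists>W. openin X W \<and> x \<in> W \<and> W \<subseteq> U \<inter> V \<and> restr F U W s = restr F V W t)}"

text \<open>Two germs at a point always have representatives over a common neighbourhood, so the
  following is the operation on the stalk induced by a family of operations on sections; all the
  members of the union coincide.\<close>

definition stalk_op ::
  "'a topology \<Rightarrow> ('a, 's, ('s, 'e) ring_scheme) presheaf \<Rightarrow> ('a set \<Rightarrow> 's \<Rightarrow> 's \<Rightarrow> 's) \<Rightarrow>
   'a \<Rightarrow> ('a, 's) germ \<Rightarrow> ('a, 's) germ \<Rightarrow> ('a, 's) germ" where
  "stalk_op X F op x g h = \<Union>{germ X F x U (op U s t) | U s t. (U, s) \<in> g \<and> (U, t) \<in> h}"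

definition stalk_smult ::
  "'a topology \<Rightarrow> ('a, 'r) ring_presheaf \<Rightarrow> ('a, 'r, 's) module_presheaf \<Rightarrow>
   'a \<Rightarrow> 'a set \<Rightarrow> 'r \<Rightarrow> ('a, 's) germ \<Rightarrow> ('a, 's) germ" where
  "stalk_smult X R F x U f g =
     \<Union>{germ X F x V (restr R U V f \<odot>\<^bsub>sect F V\<^esub> t) | V t. (V, t) \<in> g \<and> V \<subseteq> U}"

text \<open>Sections of the inverse image \<open>f\<^sup>-\<^sup>1 Q\<close> of a presheaf on \<open>Y\<close> under \<open>f : X \<rightarrow> Y\<close>, as
  compatible families of germs: \<open>s x\<close> is a germ of \<open>Q\<close> at \<open>f x\<close>,
  and locally all these germs come from one section of \<open>Q\<close>.  As \<open>Q\<close> and its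
  sheafification have the same stalks, this is also the inverse image of the sheafification of \<open>Q\<close>;
  for \<open>f = id\<close> it is the sheafification itself.\<close>

definition inverse_image_sections ::
  "'a topology \<Rightarrow> 'b topology \<Rightarrow> ('a \<Rightarrow> 'b) \<Rightarrow> ('b, 's, ('s, 'e) ring_scheme) presheaf \<Rightarrow>
   'a set \<Rightarrow> ('a \<Rightarrow> ('b, 's) germ) set" where
  "inverse_image_sections X Y f Q U = {s \<in> extensional U. \<forall>x\<in>U.
     \<exists>V W q. openin X V \<and> x \<in> V \<and> V \<subseteq> U \<and> openin Y W \<and> f ` V \<subseteq> W \<and>
       q \<in> carrier (sect Q W) \<and> (\<forall>y\<in>V. s y = germ Y Q (f y) W q)}"

definition inverse_image_ring ::
  "'a topology \<Rightarrow> 'b topology \<Rightarrow> ('a \<Rightarrow> 'b) \<Rightarrow> ('b, 's) ring_presheaf \<Rightarrow>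
   ('a, 'a \<Rightarrow> ('b, 's) germ) ring_presheaf" where
  "inverse_image_ring X Y f Q = \<lparr>
     sect = (\<lambda>U. \<lparr>
       carrier = inverse_image_sections X Y f Q U,
       monoid.mult = (\<lambda>s t. \<lambda>x\<in>U. stalk_op Y Q (\<lambda>W. monoid.mult (sect Q W)) (f x) (s x) (t x)),
       one = (\<lambda>x\<in>U. germ Y Q (f x) (topspace Y) \<one>\<^bsub>sect Q (topspace Y)\<^esub>),
       ring.zero = (\<lambda>x\<in>U. germ Y Q (f x) (topspace Y) \<zero>\<^bsub>sect Q (topspace Y)\<^esub>),
       add = (\<lambda>s t. \<lambda>x\<in>U. stalk_op Y Q (\<lambda>W. add (sect Q W)) (f x) (s x) (t x))\<rparr>),
     restr = (\<lambda>U V s. restrict s V)\<rparr>"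

text \<open>The record type of modules extends that of rings; its fields \<open>mult\<close> and
  \<open>one\<close> play no role for modules and are left unspecified.\<close>

definition mk_module :: "'m set \<Rightarrow> 'm \<Rightarrow> ('m \<Rightarrow> 'm \<Rightarrow> 'm) \<Rightarrow> ('r \<Rightarrow> 'm \<Rightarrow> 'm) \<Rightarrow> ('r, 'm) module" where
  "mk_module C z p m =
     \<lparr>carrier = C, monoid.mult = undefined, one = undefined, ring.zero = z, add = p, smult = m\<rparr>"

definition sheafify_module ::
  "'a topology \<Rightarrow> ('a, 'r) ring_presheaf \<Rightarrow> ('a, 'r, 's) module_presheaf \<Rightarrow>
   ('a, 'r, 'a \<Rightarrow> ('a, 's) germ) module_presheaf" where
  "sheafify_module X R F = \<lparr>
     sect = (\<lambda>U. mk_module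
       (inverse_image_sections X X id F U)
       (\<lambda>x\<in>U. germ X F x (topspace X) \<zero>\<^bsub>sect F (topspace X)\<^esub>)
       (\<lambda>s t. \<lambda>x\<in>U. stalk_op X F (\<lambda>V. add (sect F V)) x (s x) (t x))
       (\<lambda>f s. \<lambda>x\<in>U. stalk_smult X R F x U f (s x))),
     restr = (\<lambda>U V s. restrict s V)\<rparr>"

text \<open>The morphism from the sheafification of a presheaf \<open>F\<close> to a sheaf \<open>G\<close>
  determined by a morphism \<open>h\<close> of presheaves from \<open>F\<close> to \<open>G\<close>.\<close>

definition sheafify_lift ::
  "'a topology \<Rightarrow> ('a, 'r, 's) module_presheaf \<Rightarrow> ('a, 'r, 't) module_presheaf \<Rightarrow>
   ('a set \<Rightarrow> 's \<Rightarrow> 't) \<Rightarrow> 'a set \<Rightarrow> ('a \<Rightarrow> ('a, 's) germ) \<Rightarrow> 't" where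
  "sheafify_lift X F G h U s = (THE t. t \<in> carrier (sect G U) \<and>
     (\<forall>x\<in>U. \<exists>V q. openin X V \<and> x \<in> V \<and> V \<subseteq> U \<and> q \<in> carrier (sect F V) \<and>
        (\<forall>y\<in>V. s y = germ X F y V q) \<and> restr G U V t = h V q))"

definition linear_maps ::
  "('r, 'e) ring_scheme \<Rightarrow> ('r, 'm) module \<Rightarrow> ('r, 'n) module \<Rightarrow> ('m \<Rightarrow> 'n) set" where
  "linear_maps R M N = {h \<in> carrier M \<rightarrow> carrier N.
     (\<forall>x\<in>carrier M. \<forall>y\<in>carrier M. h (x \<oplus>\<^bsub>M\<^esub> y) = h x \<oplus>\<^bsub>N\<^esub> h y) \<and>
     (\<forall>r\<in>carrier R. \<forall>x\<in>carrier M. h (r \<odot>\<^bsub>M\<^esub> x) = r \<odot>\<^bsub>N\<^esub> h x)}"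

definition module_presheaf_hom ::
  "'a topology \<Rightarrow> ('a, 'r) ring_presheaf \<Rightarrow> ('a, 'r, 's) module_presheaf \<Rightarrow>
   ('a, 'r, 't) module_presheaf \<Rightarrow> ('a set \<Rightarrow> 's \<Rightarrow> 't) \<Rightarrow> bool" where
  "module_presheaf_hom X R F G h \<longleftrightarrow>
     (\<forall>U. openin X U \<longrightarrow> h U \<in> linear_maps (sect R U) (sect F U) (sect G U)) \<and>
     (\<forall>U V. openin X U \<longrightarrow> openin X V \<longrightarrow> V \<subseteq> U \<longrightarrow>
        (\<forall>s\<in>carrier (sect F U). h V (restr F U V s) = restr G U V (h U s)))"


section \<open>Tensor products of modules\<close>

definition tensor_relations ::
  "('r, 'e) ring_scheme \<Rightarrow> ('r, 'm) module \<Rightarrow> ('r, 'n) module \<Rightarrow> ('m \<times> 'n \<Rightarrow>\<^sub>0 int) set" where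
  "tensor_relations R M N =
     {frag_of (m \<oplus>\<^bsub>M\<^esub> m', n) - frag_of (m, n) - frag_of (m', n) | m m' n.
        m \<in> carrier M \<and> m' \<in> carrier M \<and> n \<in> carrier N} \<union>
     {frag_of (m, n \<oplus>\<^bsub>N\<^esub> n') - frag_of (m, n) - frag_of (m, n') | m n n'.
        m \<in> carrier M \<and> n \<in> carrier N \<and> n' \<in> carrier N} \<union>
     {frag_of (r \<odot>\<^bsub>M\<^esub> m, n) - frag_of (m, r \<odot>\<^bsub>N\<^esub> n) | r m n.
        r \<in> carrier R \<and> m \<in> carrier M \<and> n \<in> carrier N}"

definition tensor_null ::
  "('r, 'e) ring_scheme \<Rightarrow> ('r, 'm) module \<Rightarrow> ('r, 'n) module \<Rightarrow> ('m \<times> 'n \<Rightarrow>\<^sub>0 int) set" where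
  "tensor_null R M N =
     generate (free_Abelian_group (carrier M \<times> carrier N)) (tensor_relations R M N)"

definition tensor_group ::
  "('r, 'e) ring_scheme \<Rightarrow> ('r, 'm) module \<Rightarrow> ('r, 'n) module \<Rightarrow> ('m \<times> 'n \<Rightarrow>\<^sub>0 int) set monoid" where
  "tensor_group R M N = free_Abelian_group (carrier M \<times> carrier N) Mod tensor_null R M N"

text \<open>The map induced on tensor products by \<open>m \<otimes> n \<mapsto> \<phi> m \<otimes> \<psi> n\<close>;
  the arguments \<open>R M N\<close> describe the target.  All the members of the union coincide.\<close>

definition tensor_map ::
  "('r, 'e) ring_scheme \<Rightarrow> ('r, 'm) module \<Rightarrow> ('r, 'n) module \<Rightarrow> ('k \<Rightarrow> 'm) \<Rightarrow> ('l \<Rightarrow> 'n) \<Rightarrow>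
   ('k \<times> 'l \<Rightarrow>\<^sub>0 int) set \<Rightarrow> ('m \<times> 'n \<Rightarrow>\<^sub>0 int) set" where
  "tensor_map R M N \<phi> \<psi> T =
     (\<Union>c\<in>T. tensor_null R M N #>\<^bsub>free_Abelian_group (carrier M \<times> carrier N)\<^esub>
        frag_extend (\<lambda>(m, n). frag_of (\<phi> m, \<psi> n)) c)"

text \<open>The value at an element of a tensor product of the additive map with
  \<open>m \<otimes> n \<mapsto> \<beta> m n\<close>, for a balanced biadditive \<open>\<beta>\<close> with values in \<open>P\<close>.\<close>

definition tensor_induced ::
  "('r, 'p) module \<Rightarrow> ('m \<Rightarrow> 'n \<Rightarrow> 'p) \<Rightarrow> ('m \<times> 'n \<Rightarrow>\<^sub>0 int) set \<Rightarrow> 'p" where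
  "tensor_induced P \<beta> T = the_elem ((\<lambda>c.
     \<Oplus>\<^bsub>P\<^esub>k\<in>Poly_Mapping.keys c. [Poly_Mapping.lookup c k] \<cdot>\<^bsub>P\<^esub> case_prod \<beta> k) ` T)"


section \<open>Holomorphic functions and the first infinitesimal neighbourhood of the diagonal\<close>

definition hol_ring :: "('a, 'n::finite) chart set \<Rightarrow> 'a set \<Rightarrow> ('a \<Rightarrow> complex) ring" where
  "hol_ring A U = \<lparr>
     carrier = {f \<in> extensional U.
       \<forall>(V, \<phi>)\<in>A. holomorphic_many (\<lambda>z. f (inv_into V \<phi> z)) (\<phi> ` (U \<inter> V))},
     monoid.mult = (\<lambda>f g. \<lambda>x\<in>U. f x * g x),
     one = (\<lambda>x\<in>U. 1),
     ring.zero = (\<lambda>x\<in>U. 0),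
     add = (\<lambda>f g. \<lambda>x\<in>U. f x + g x)\<rparr>"

definition hol_sheaf :: "('a, 'n::finite) chart set \<Rightarrow> ('a, 'a \<Rightarrow> complex) ring_presheaf" where
  "hol_sheaf A = \<lparr>sect = hol_ring A, restr = (\<lambda>U V f. restrict f V)\<rparr>"

definition diag :: "'a \<Rightarrow> 'a \<times> 'a" where
  "diag x = (x, x)"

definition diag_ideal :: "('a, 'n::finite) chart set \<Rightarrow> ('a \<times> 'a) set \<Rightarrow> ('a \<times> 'a \<Rightarrow> complex) set" where
  "diag_ideal A W = {f \<in> carrier (hol_ring (prod_atlas A A) W). \<forall>x. diag x \<in> W \<longrightarrow> f (diag x) = 0}"

definition diag_ideal_sq :: "('a, 'n::finite) chart set \<Rightarrow> ('a \<times> 'a) set \<Rightarrow> ('a \<times> 'a \<Rightarrow> complex) set" where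
  "diag_ideal_sq A W = diag_ideal A W \<cdot>\<^bsub>hol_ring (prod_atlas A A) W\<^esub> diag_ideal A W"

text \<open>The presheaf on \<open>X \<times> X\<close> whose sheafification is the quotient of the structure
  sheaf by the square of the ideal sheaf of the diagonal.\<close>

definition diag_quotient ::
  "('a, 'n::finite) chart set \<Rightarrow> ('a \<times> 'a, ('a \<times> 'a \<Rightarrow> complex) set) ring_presheaf" where
  "diag_quotient A = \<lparr>
     sect = (\<lambda>W. hol_ring (prod_atlas A A) W Quot diag_ideal_sq A W),
     restr = (\<lambda>W W' c. \<Union>f\<in>c. diag_ideal_sq A W' +>\<^bsub>hol_ring (prod_atlas A A) W'\<^esub> restrict f W')\<rparr>"

type_synonym 'a jet_fun = "'a \<Rightarrow> ('a \<times> 'a, ('a \<times> 'a \<Rightarrow> complex) set) germ"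

text \<open>The structure sheaf of the first infinitesimal neighbourhood \<open>X\<^sup>(\<^sup>1\<^sup>)\<close>, whose
  underlying space is the diagonal, identified with \<open>X\<close>.\<close>

definition nbhd_sheaf :: "'a topology \<Rightarrow> ('a, 'n::finite) chart set \<Rightarrow> ('a, 'a jet_fun) ring_presheaf" where
  "nbhd_sheaf X A = inverse_image_ring X (prod_topology X X) diag (diag_quotient A)"

text \<open>Pullback of functions along a projection \<open>pr \<in> {fst, snd}\<close> from
  \<open>X\<^sup>(\<^sup>1\<^sup>)\<close> to \<open>X\<close>.\<close>

definition nbhd_pullback ::
  "'a topology \<Rightarrow> ('a, 'n::finite) chart set \<Rightarrow> ('a \<times> 'a \<Rightarrow> 'a) \<Rightarrow> 'a set \<Rightarrow>
   ('a \<Rightarrow> complex) \<Rightarrow> 'a jet_fun" where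
  "nbhd_pullback X A pr U f = (\<lambda>x\<in>U. germ (prod_topology X X) (diag_quotient A) (diag x) (U \<times> U)
     (diag_ideal_sq A (U \<times> U) +>\<^bsub>hol_ring (prod_atlas A A) (U \<times> U)\<^esub> (\<lambda>z\<in>U \<times> U. f (pr z))))"

text \<open>Restriction of functions from \<open>X\<^sup>(\<^sup>1\<^sup>)\<close> to the diagonal.\<close>

definition nbhd_restrict :: "'a set \<Rightarrow> 'a jet_fun \<Rightarrow> 'a \<Rightarrow> complex" where
  "nbhd_restrict U a = (\<lambda>x\<in>U. the_elem {h (diag x) | h W c. (W, c) \<in> a x \<and> h \<in> c})"


section \<open>First jets and holomorphic connections\<close>

text \<open>The tensor product over the holomorphic functions uses the module structure on the
  structure sheaf of \<open>X\<^sup>(\<^sup>1\<^sup>)\<close> given by the second projection; the first projection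
  gives the module structure of the result.\<close>

definition nbhd_module ::
  "'a topology \<Rightarrow> ('a, 'n::finite) chart set \<Rightarrow> 'a set \<Rightarrow> ('a \<Rightarrow> complex, 'a jet_fun) module" where
  "nbhd_module X A U = mk_module
     (carrier (sect (nbhd_sheaf X A) U)) \<zero>\<^bsub>sect (nbhd_sheaf X A) U\<^esub> (add (sect (nbhd_sheaf X A) U))
     (\<lambda>f a. nbhd_pullback X A snd U f \<otimes>\<^bsub>sect (nbhd_sheaf X A) U\<^esub> a)"

definition jet_presheaf ::
  "'a topology \<Rightarrow> ('a, 'n::finite) chart set \<Rightarrow> ('a, 'a \<Rightarrow> complex, 's) module_presheaf \<Rightarrow>
   ('a, 'a \<Rightarrow> complex, ('a jet_fun \<times> 's \<Rightarrow>\<^sub>0 int) set) module_presheaf" where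
  "jet_presheaf X A F = \<lparr>
     sect = (\<lambda>U. let T = tensor_group (hol_ring A U) (nbhd_module X A U) (sect F U) in mk_module
       (carrier T) \<one>\<^bsub>T\<^esub> (monoid.mult T)
       (\<lambda>f. tensor_map (hol_ring A U) (nbhd_module X A U) (sect F U)
          (\<lambda>a. nbhd_pullback X A fst U f \<otimes>\<^bsub>sect (nbhd_sheaf X A) U\<^esub> a) id)),
     restr = (\<lambda>U V. tensor_map (hol_ring A V) (nbhd_module X A V) (sect F V)
       (restr (nbhd_sheaf X A) U V) (restr F U V))\<rparr>"

definition jet_sheaf ::
  "'a topology \<Rightarrow> ('a, 'n::finite) chart set \<Rightarrow> ('a, 'a \<Rightarrow> complex, 's) module_presheaf \<Rightarrow>
   ('a, 'a \<Rightarrow> complex, 'a \<Rightarrow> ('a, ('a jet_fun \<times> 's \<Rightarrow>\<^sub>0 int) set) germ) module_presheaf" where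
  "jet_sheaf X A F = sheafify_module X (hol_sheaf A) (jet_presheaf X A F)"

text \<open>The projection \<open>\<pi>\<close> from first jets to \<open>F\<close>, that is
  \<open>a \<otimes> s \<mapsto> a|\<^sub>\<Delta> s\<close>.\<close>

definition jet_proj ::
  "'a topology \<Rightarrow> ('a, 'n::finite) chart set \<Rightarrow> ('a, 'a \<Rightarrow> complex, 's) module_presheaf \<Rightarrow>
   'a set \<Rightarrow> ('a \<Rightarrow> ('a, ('a jet_fun \<times> 's \<Rightarrow>\<^sub>0 int) set) germ) \<Rightarrow> 's" where
  "jet_proj X A F = sheafify_lift X (jet_presheaf X A F) F
     (\<lambda>U. tensor_induced (sect F U) (\<lambda>a s. nbhd_restrict U a \<odot>\<^bsub>sect F U\<^esub> s))"

definition holomorphic_connection ::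
  "'a topology \<Rightarrow> ('a, 'n::finite) chart set \<Rightarrow> ('a, 'a \<Rightarrow> complex, 's) module_presheaf \<Rightarrow>
   ('a set \<Rightarrow> 's \<Rightarrow> 'a \<Rightarrow> ('a, ('a jet_fun \<times> 's \<Rightarrow>\<^sub>0 int) set) germ) \<Rightarrow> bool" where
  "holomorphic_connection X A F D \<longleftrightarrow>
     module_presheaf_hom X (hol_sheaf A) F (jet_sheaf X A F) D \<and>
     (\<forall>U. openin X U \<longrightarrow> (\<forall>s\<in>carrier (sect F U). jet_proj X A F U (D U s) = s))"


section \<open>Skyscraper sheaves\<close>

text \<open>The direct image of the structure sheaf of the point \<open>p\<close>: the sections over
  \<open>U\<close> are the complex numbers if \<open>p \<in> U\<close>, and zero otherwise.\<close>

definition skyscraper :: "'a \<Rightarrow> ('a, 'a \<Rightarrow> complex, complex) module_presheaf" where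
  "skyscraper p = \<lparr>
     sect = (\<lambda>U. mk_module {c. p \<notin> U \<longrightarrow> c = 0} 0 (+) (\<lambda>f c. if p \<in> U then f p * c else 0)),
     restr = (\<lambda>U V c. if p \<in> V then c else 0)\<rparr>"

end

theory Submission
  imports Defs
begin

text \<open>Suppose \<open>D\<close> is a connection on the skyscraper at \<open>p\<close>, let \<open>f\<close> be a chart coordinate
  vanishing at \<open>p\<close>, and put \<open>s = D 1\<close>. Since \<open>f\<close> annihilates the skyscraper,
  \<open>f \<cdot> s = D (f \<cdot> 1) = 0\<close>. The fibre of the jets at \<open>p\<close> consists of functions
  \<open>h (x, p)\<close> modulo the square of the maximal ideal at \<open>x = p\<close>, so the evaluation
  \<open>h (p, p)\<close>, which is \<open>\<pi>\<close>, and the derivative of \<open>h (x, p)\<close> at \<open>x = p\<close>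
  in the direction of the coordinate \<open>f\<close> are well-defined functionals on it. By the Leibniz rule
  the derivative of \<open>f \<cdot> s\<close> is \<open>\<pi> s = 1\<close>, a contradiction.\<close>

section \<open>Holomorphic functions and charts\<close>

text \<open>A stalk of the jet sheaf lies behind four identifications: functions near
  \<open>(p, p)\<close> modulo the squared diagonal ideal, germs of these classes, formal sums
  modulo the tensor relations, and germs again from sheafification. None of these quotients is
  computed. A functional is given on representatives and shown to be constant on each class in turn,
  so that numbers can be read off from arbitrary representatives. The choice of variable makes the
  derivative work. The tensor product is balanced over pullbacks along \<open>snd\<close>, whereas
  functions act on jets through \<open>fst\<close>. Differentiating in the first variable with the
  second fixed at \<open>p\<close> treats the balancing scalars as constants and still sees the
  derivative of the acting function. The projection \<pi> is a definite description on a
  sheafification, so evaluating it takes existence and uniqueness; away from \<open>p\<close>,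
  existence rests on \<open>p\<close> being a closed point.\<close>

lemma holomorphic_many_const: "holomorphic_many (\<lambda>z. c) S"
  unfolding holomorphic_many_def by (auto intro!: exI[of _ "\<lambda>v. 0"])

lemma holomorphic_many_add:
  assumes "holomorphic_many f S" "holomorphic_many g S"
  shows "holomorphic_many (\<lambda>z. f z + g z) S"
  unfolding holomorphic_many_def
proof
  fix z assume "z \<in> S"
  then obtain D E where "(f has_derivative D) (at z)" "\<forall>c v. D (c *s v) = c * D v"
    "(g has_derivative E) (at z)" "\<forall>c v. E (c *s v) = c * E v"
    using assms unfolding holomorphic_many_def by metis
  then show "\<exists>D. ((\<lambda>z. f z + g z) has_derivative D) (at z) \<and> (\<forall>c v. D (c *s v) = c * D v)"
    by (intro exI[of _ "\<lambda>v. D v + E v"] conjI has_derivative_add) (auto simp: algebra_simps)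
qed

lemma holomorphic_many_mult:
  assumes "holomorphic_many f S" "holomorphic_many g S"
  shows "holomorphic_many (\<lambda>z. f z * g z) S"
  unfolding holomorphic_many_def
proof
  fix z assume "z \<in> S"
  then obtain D E where "(f has_derivative D) (at z)" "\<forall>c v. D (c *s v) = c * D v"
    "(g has_derivative E) (at z)" "\<forall>c v. E (c *s v) = c * E v"
    using assms unfolding holomorphic_many_def by metis
  then show "\<exists>D. ((\<lambda>z. f z * g z) has_derivative D) (at z) \<and> (\<forall>c v. D (c *s v) = c * D v)"
    by (intro exI[of _ "\<lambda>v. f z * E v + D v * g z"] conjI has_derivative_mult)
       (auto simp: algebra_simps)
qed

lemma holomorphic_many_uminus: "holomorphic_many f S \<Longrightarrow> holomorphic_many (\<lambda>z. - f z) S"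
  using holomorphic_many_mult[OF holomorphic_many_const[of "-1"]] by force

text \<open>Derivatives are taken in the full filter \<open>at z\<close>, so agreement has to hold
  on an open set around \<open>z\<close>, not merely on a set containing it.\<close>

lemma holomorphic_many_cong:
  assumes "holomorphic_many f S" "open T" "T \<subseteq> S" "\<And>z. z \<in> T \<Longrightarrow> f z = g z"
  shows "holomorphic_many g T"
  unfolding holomorphic_many_def
proof
  fix z assume z: "z \<in> T"
  with assms obtain D where "(f has_derivative D) (at z)" "\<forall>c v. D (c *s v) = c * D v"
    unfolding holomorphic_many_def by blast
  then show "\<exists>D. (g has_derivative D) (at z) \<and> (\<forall>c v. D (c *s v) = c * D v)"
    using has_derivative_transform_within_open[OF _ assms(2) z] assms(4) by blast
qed

text \<open>Chain rule, meant for the two block projections of a product chart; linearity over the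
  complex scalars keeps the composed derivative complex linear.\<close>

lemma holomorphic_many_compose_linear:
  fixes L :: "complex ^ 'm::finite \<Rightarrow> complex ^ 'n::finite"
  assumes "holomorphic_many f S" "bounded_linear L" "\<And>c v. L (c *s v) = c *s L v" "L ` T \<subseteq> S"
  shows "holomorphic_many (\<lambda>z. f (L z)) T"
  unfolding holomorphic_many_def
proof
  fix z assume z: "z \<in> T"
  with assms(1,4) obtain D where D: "(f has_derivative D) (at (L z))" "\<forall>c v. D (c *s v) = c * D v"
    unfolding holomorphic_many_def by blast
  have "((\<lambda>z. f (L z)) has_derivative (\<lambda>v. D (L v))) (at z)"
    using diff_chain_at[OF bounded_linear_imp_has_derivative[OF assms(2)] D(1)] by (simp add: o_def)
  then show "\<exists>D. ((\<lambda>z. f (L z)) has_derivative D) (at z) \<and> (\<forall>c v. D (c *s v) = c * D v)"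
    using D(2) assms(3) by (intro exI[of _ "\<lambda>v. D (L v)"]) auto
qed

text \<open>Passes from several variables to one: by complex linearity the derivative along
  \<open>v\<close> is multiplication by the number \<open>D v\<close>, so \<open>deriv\<close> and
  its rules become available.\<close>

lemma holomorphic_many_along_line:
  fixes z v :: "complex ^ 'n::finite"
  assumes "holomorphic_many f S" "z \<in> S"
  shows "(\<lambda>t. f (z + t *s v)) field_differentiable at 0"
proof -
  obtain D where D: "(f has_derivative D) (at z)" "\<forall>c v. D (c *s v) = c * D v"
    using assms unfolding holomorphic_many_def by blast
  have "bounded_linear (\<lambda>t::complex. t *s v)"
    by (intro linear_conv_bounded_linear[THEN iffD1] linearI) (simp_all add: vec_eq_iff distrib_right)
  then have "((\<lambda>t. z + t *s v) has_derivative (\<lambda>t. t *s v)) (at 0)"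
    by (auto intro!: derivative_eq_intros bounded_linear_imp_has_derivative)
  from diff_chain_at[OF this, of f D] D
  have "((\<lambda>t. f (z + t *s v)) has_derivative (\<lambda>t. D v * t)) (at 0)"
    by (simp add: o_def mult.commute)
  then show ?thesis
    unfolding field_differentiable_def has_field_derivative_def
    by (intro exI[of _ "D v"]) simp
qed

text \<open>The topological facts about charts behind the computations with \<open>hol_ring\<close>.
  In this form they pass to \<open>prod_atlas\<close>, so \<open>X\<close> and its square are
  handled by the same lemmas.\<close>

definition open_charts :: "'a topology \<Rightarrow> ('a, 'n::finite) chart set \<Rightarrow> bool" where
  "open_charts X A \<longleftrightarrow>
     (\<forall>(U, \<phi>)\<in>A. inj_on \<phi> U \<and> (\<forall>W. openin X W \<longrightarrow> open (\<phi> ` (W \<inter> U))))"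

lemma open_charts_inj: "open_charts X A \<Longrightarrow> (U, \<phi>) \<in> A \<Longrightarrow> inj_on \<phi> U"
  and open_charts_open: "open_charts X A \<Longrightarrow> (U, \<phi>) \<in> A \<Longrightarrow> openin X W \<Longrightarrow> open (\<phi> ` (W \<inter> U))"
  unfolding open_charts_def by auto

lemma complex_atlas_open_charts:
  assumes "complex_atlas X A"
  shows "open_charts X A"
  unfolding open_charts_def
proof clarify
  fix U \<phi> assume "(U, \<phi>) \<in> A"
  with assms have U: "openin X U" "open (\<phi> ` U)"
    and h: "homeomorphic_map (subtopology X U) (top_of_set (\<phi> ` U)) \<phi>"
    unfolding complex_atlas_def by auto
  have "inj_on \<phi> U"
    using homeomorphic_imp_injective_map[OF h] openin_subset[OF U(1)] by (simp add: inf_absorb2)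
  moreover have "open (\<phi> ` (W \<inter> U))" if "openin X W" for W
  proof -
    have "openin (top_of_set (\<phi> ` U)) (\<phi> ` (W \<inter> U))"
      using homeomorphic_imp_open_map[OF h] that
      unfolding open_map_def by (auto simp: openin_subtopology)
    then show ?thesis using U(2) openin_open_trans by blast
  qed
  ultimately show "inj_on \<phi> U \<and> (\<forall>W. openin X W \<longrightarrow> open (\<phi> ` (W \<inter> U)))" by blast
qed

section \<open>Coordinates in a product of two charts\<close>

definition vec_append :: "'c ^ 'n::finite \<Rightarrow> 'c ^ 'm::finite \<Rightarrow> 'c ^ ('n + 'm)" where
  "vec_append a b = (\<chi> i. case i of Inl j \<Rightarrow> a $ j | Inr k \<Rightarrow> b $ k)"

definition vec_left :: "'c ^ ('n::finite + 'm::finite) \<Rightarrow> 'c ^ 'n" where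
  "vec_left z = (\<chi> j. z $ Inl j)"

definition vec_right :: "'c ^ ('n::finite + 'm::finite) \<Rightarrow> 'c ^ 'm" where
  "vec_right z = (\<chi> k. z $ Inr k)"

lemma vec_left_append [simp]: "vec_left (vec_append a b) = a"
  and vec_right_append [simp]: "vec_right (vec_append a b) = b"
  and vec_append_left_right [simp]: "vec_append (vec_left z) (vec_right z) = z"
  by (auto simp: vec_eq_iff vec_append_def vec_left_def vec_right_def split: sum.split)

lemma vec_left_smult: "vec_left (c *s z) = c *s vec_left z"
  and vec_right_smult: "vec_right (c *s z) = c *s vec_right z"
  by (auto simp: vec_eq_iff vec_left_def vec_right_def)

lemma bounded_linear_vec_left: "bounded_linear (vec_left :: complex ^ ('n::finite + 'm::finite) \<Rightarrow> _)"
  by (intro linear_conv_bounded_linear[THEN iffD1] linearI) (auto simp: vec_eq_iff vec_left_def)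

lemma bounded_linear_vec_right: "bounded_linear (vec_right :: complex ^ ('n::finite + 'm::finite) \<Rightarrow> _)"
  by (intro linear_conv_bounded_linear[THEN iffD1] linearI) (auto simp: vec_eq_iff vec_right_def)

lemma prod_chart_eq:
  "prod_chart (U, \<phi>) (V, \<psi>) = (U \<times> V, \<lambda>(x, y). vec_append (\<phi> x) (\<psi> y))"
  by (simp add: prod_chart_def vec_append_def)

lemma open_vec_append:
  fixes S :: "(complex ^ 'n::finite) set" and T :: "(complex ^ 'm::finite) set"
  assumes "open S" "open T"
  shows "open {z. vec_left z \<in> S \<and> vec_right z \<in> T}"
proof -
  have "{z. vec_left z \<in> S \<and> vec_right z \<in> T} = vec_left -` S \<inter> vec_right -` T" by auto
  moreover have "open (vec_left -` S :: (complex ^ ('n + 'm)) set)"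
    by (intro continuous_open_vimage assms)
       (simp add: bounded_linear.isCont[OF bounded_linear_vec_left])
  moreover have "open (vec_right -` T :: (complex ^ ('n + 'm)) set)"
    by (intro continuous_open_vimage assms)
       (simp add: bounded_linear.isCont[OF bounded_linear_vec_right])
  ultimately show ?thesis by auto
qed

text \<open>Each point of an open set lies in an open box, and the image of a box under a product
  chart is cut out by open conditions on the two blocks of coordinates.\<close>

lemma open_charts_prod:
  assumes "open_charts X A" "open_charts Y B"
  shows "open_charts (prod_topology X Y) (prod_atlas A B)"
  unfolding open_charts_def
proof clarify
  fix C \<Phi> assume "(C, \<Phi>) \<in> prod_atlas A B"
  then obtain U \<phi> V \<psi> where UV: "(U, \<phi>) \<in> A" "(V, \<psi>) \<in> B" and C: "C = U \<times> V"
    and \<Phi>: "\<Phi> = (\<lambda>(x, y). vec_append (\<phi> x) (\<psi> y))"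
    unfolding prod_atlas_def by (auto simp: prod_chart_eq)
  have ap: "\<phi> x = \<phi> x' \<and> \<psi> y = \<psi> y'" if "vec_append (\<phi> x) (\<psi> y) = vec_append (\<phi> x') (\<psi> y')" for x y x' y'
    using that by (metis vec_left_append vec_right_append)
  have "inj_on \<Phi> C"
    unfolding C \<Phi> inj_on_def
    using open_charts_inj[OF assms(1) UV(1)] open_charts_inj[OF assms(2) UV(2)]
    by (auto dest!: ap simp: inj_on_def)
  moreover have "open (\<Phi> ` (W \<inter> C))" if W: "openin (prod_topology X Y) W" for W
    unfolding open_subopen[of "\<Phi> ` (W \<inter> C)"]
  proof
    fix z assume "z \<in> \<Phi> ` (W \<inter> C)"
    then obtain x y where xy: "(x, y) \<in> W" "x \<in> U" "y \<in> V" "z = vec_append (\<phi> x) (\<psi> y)"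
      by (auto simp: C \<Phi>)
    from W xy(1) obtain S T where ST: "openin X S" "openin Y T" "x \<in> S" "y \<in> T" "S \<times> T \<subseteq> W"
      unfolding openin_prod_topology_alt by meson
    let ?N = "{w. vec_left w \<in> \<phi> ` (S \<inter> U) \<and> vec_right w \<in> \<psi> ` (T \<inter> V)}"
    have "open ?N"
      by (intro open_vec_append open_charts_open[OF assms(1) UV(1) ST(1)]
          open_charts_open[OF assms(2) UV(2) ST(2)])
    moreover have "z \<in> ?N" using xy ST by auto
    moreover have "?N \<subseteq> \<Phi> ` (W \<inter> C)"
    proof
      fix w assume "w \<in> ?N"
      then obtain a b where ab: "a \<in> S" "a \<in> U" "b \<in> T" "b \<in> V" "vec_left w = \<phi> a" "vec_right w = \<psi> b" by auto
      then have "w = \<Phi> (a, b)" using vec_append_left_right[of w] by (simp add: \<Phi>)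
      moreover have "(a, b) \<in> W \<inter> C" using ab ST(5) by (auto simp: C)
      ultimately show "w \<in> \<Phi> ` (W \<inter> C)" by blast
    qed
    ultimately show "\<exists>T. open T \<and> z \<in> T \<and> T \<subseteq> \<Phi> ` (W \<inter> C)" by blast
  qed
  ultimately show "inj_on \<Phi> C \<and> (\<forall>W. openin (prod_topology X Y) W \<longrightarrow> open (\<Phi> ` (W \<inter> C)))" by blast
qed

section \<open>Rings of holomorphic functions\<close>

lemma hol_ring_simps [simp]:
  "f \<otimes>\<^bsub>hol_ring A U\<^esub> g = (\<lambda>x\<in>U. f x * g x)"
  "f \<oplus>\<^bsub>hol_ring A U\<^esub> g = (\<lambda>x\<in>U. f x + g x)"
  "\<one>\<^bsub>hol_ring A U\<^esub> = (\<lambda>x\<in>U. 1)"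
  "\<zero>\<^bsub>hol_ring A U\<^esub> = (\<lambda>x\<in>U. 0)"
  by (simp_all add: hol_ring_def)

lemma hol_ring_carrierI:
  assumes "f \<in> extensional U"
    "\<And>V \<phi>. (V, \<phi>) \<in> A \<Longrightarrow> holomorphic_many (\<lambda>z. f (inv_into V \<phi> z)) (\<phi> ` (U \<inter> V))"
  shows "f \<in> carrier (hol_ring A U)"
  using assms by (auto simp: hol_ring_def)

lemma hol_ring_carrierD:
  assumes "f \<in> carrier (hol_ring A U)"
  shows "f \<in> extensional U"
    "(V, \<phi>) \<in> A \<Longrightarrow> holomorphic_many (\<lambda>z. f (inv_into V \<phi> z)) (\<phi> ` (U \<inter> V))"
  using assms by (auto simp: hol_ring_def)

lemma hol_ring_carrier_congI:
  assumes X: "open_charts X A" "openin X U" and f: "f \<in> extensional U"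
    and g: "\<And>V \<phi>. (V, \<phi>) \<in> A \<Longrightarrow> holomorphic_many (\<lambda>z. g (inv_into V \<phi> z)) (\<phi> ` (U \<inter> V))"
    and eq: "\<And>x. x \<in> U \<Longrightarrow> f x = g x"
  shows "f \<in> carrier (hol_ring A U)"
proof (rule hol_ring_carrierI[OF f])
  fix V \<phi> assume V: "(V, \<phi>) \<in> A"
  show "holomorphic_many (\<lambda>z. f (inv_into V \<phi> z)) (\<phi> ` (U \<inter> V))"
    by (rule holomorphic_many_cong[OF g[OF V] open_charts_open[OF X(1) V X(2)]])
       (use open_charts_inj[OF X(1) V] eq in \<open>auto simp: inj_on_def\<close>)
qed

context
  fixes X :: "'a topology" and A :: "('a, 'n::finite) chart set" and U :: "'a set"
  assumes X: "open_charts X A" "openin X U"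
begin

lemma hol_ring_const_closed: "(\<lambda>x\<in>U. c) \<in> carrier (hol_ring A U)"
  by (rule hol_ring_carrier_congI[OF X, where g = "\<lambda>x. c"]) (auto intro: holomorphic_many_const)

lemma hol_ring_add_closed:
  "f \<in> carrier (hol_ring A U) \<Longrightarrow> g \<in> carrier (hol_ring A U) \<Longrightarrow>
   (\<lambda>x\<in>U. f x + g x) \<in> carrier (hol_ring A U)"
  by (rule hol_ring_carrier_congI[OF X, where g = "\<lambda>x. f x + g x"])
     (auto intro: holomorphic_many_add hol_ring_carrierD)

lemma hol_ring_mult_closed:
  "f \<in> carrier (hol_ring A U) \<Longrightarrow> g \<in> carrier (hol_ring A U) \<Longrightarrow>
   (\<lambda>x\<in>U. f x * g x) \<in> carrier (hol_ring A U)"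
  by (rule hol_ring_carrier_congI[OF X, where g = "\<lambda>x. f x * g x"])
     (auto intro: holomorphic_many_mult hol_ring_carrierD)

lemma hol_ring_uminus_closed:
  "f \<in> carrier (hol_ring A U) \<Longrightarrow> (\<lambda>x\<in>U. - f x) \<in> carrier (hol_ring A U)"
  by (rule hol_ring_carrier_congI[OF X, where g = "\<lambda>x. - f x"])
     (auto intro: holomorphic_many_uminus hol_ring_carrierD)

lemma hol_ring_cring: "cring (hol_ring A U)"
proof (rule cringI)
  show "abelian_group (hol_ring A U)"
  proof (rule abelian_groupI, goal_cases)
    case (6 f)
    have "(\<lambda>x\<in>U. - f x) \<oplus>\<^bsub>hol_ring A U\<^esub> f = \<zero>\<^bsub>hol_ring A U\<^esub>" by (auto simp: restrict_def)
    then show ?case using hol_ring_uminus_closed[OF 6] by blast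
  next
    case (5 f)
    then show ?case using hol_ring_carrierD(1)[OF 5] by (auto simp: restrict_def extensional_def)
  qed (auto simp: hol_ring_add_closed hol_ring_const_closed ac_simps intro!: restrict_ext)
  show "comm_monoid (hol_ring A U)"
  proof (rule comm_monoidI, goal_cases)
    case (4 f)
    then show ?case using hol_ring_carrierD(1)[OF 4] by (auto simp: restrict_def extensional_def)
  qed (auto simp: hol_ring_mult_closed hol_ring_const_closed ac_simps intro!: restrict_ext)
qed (auto simp: restrict_def algebra_simps)

end

lemma hol_ring_restrict:
  assumes "open_charts X A" "openin X V" "V \<subseteq> U" "f \<in> carrier (hol_ring A U)"
  shows "restrict f V \<in> carrier (hol_ring A V)"
proof (rule hol_ring_carrierI)
  fix C \<phi> assume C: "(C, \<phi>) \<in> A"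
  show "holomorphic_many (\<lambda>z. restrict f V (inv_into C \<phi> z)) (\<phi> ` (V \<inter> C))"
    by (rule holomorphic_many_cong[OF hol_ring_carrierD(2)[OF assms(4) C]
          open_charts_open[OF assms(1) C assms(2)]])
       (use open_charts_inj[OF assms(1) C] assms(3) in \<open>auto simp: inj_on_def\<close>)
qed simp

lemma inv_into_prod_chart:
  assumes "inj_on \<phi> U" "inj_on \<psi> V" "x \<in> U" "y \<in> V"
  shows "inv_into (U \<times> V) (\<lambda>(x, y). vec_append (\<phi> x) (\<psi> y)) (vec_append (\<phi> x) (\<psi> y)) = (x, y)"
proof -
  have "inj_on (\<lambda>(x, y). vec_append (\<phi> x) (\<psi> y)) (U \<times> V)"
    using assms(1,2) unfolding inj_on_def
    by clarsimp (metis vec_left_append vec_right_append)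
  from inv_into_f_f[OF this, of "(x, y)"] assms(3,4) show ?thesis by simp
qed

text \<open>In a product chart the projections of the square become the linear maps
  \<open>vec_left\<close> and \<open>vec_right\<close>.\<close>

lemma hol_ring_pullback:
  assumes X: "open_charts X A" "openin X U" and pr: "pr = fst \<or> pr = snd"
    and f: "f \<in> carrier (hol_ring A U)"
  shows "(\<lambda>z\<in>U \<times> U. f (pr z)) \<in> carrier (hol_ring (prod_atlas A A) (U \<times> U))"
proof (rule hol_ring_carrierI)
  fix C \<Phi> assume "(C, \<Phi>) \<in> prod_atlas A A"
  then obtain V \<phi> W \<psi> where VW: "(V, \<phi>) \<in> A" "(W, \<psi>) \<in> A" and C: "C = V \<times> W"
    and \<Phi>: "\<Phi> = (\<lambda>(x, y). vec_append (\<phi> x) (\<psi> y))"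
    unfolding prod_atlas_def by (auto simp: prod_chart_eq)
  note inj = open_charts_inj[OF X(1) VW(1)] open_charts_inj[OF X(1) VW(2)]
  have op: "open (\<Phi> ` (U \<times> U \<inter> C))"
    by (rule open_charts_open[OF open_charts_prod[OF X(1) X(1)] \<open>(C, \<Phi>) \<in> _\<close>])
       (simp add: openin_prod_Times_iff X)
  show "holomorphic_many (\<lambda>z. (\<lambda>z\<in>U \<times> U. f (pr z)) (inv_into C \<Phi> z)) (\<Phi> ` (U \<times> U \<inter> C))"
    using pr
  proof
    assume pr: "pr = fst"
    have "holomorphic_many (\<lambda>z. f (inv_into V \<phi> (vec_left z))) (\<Phi> ` (U \<times> U \<inter> C))"
      by (rule holomorphic_many_compose_linear[OF hol_ring_carrierD(2)[OF f VW(1)]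
            bounded_linear_vec_left vec_left_smult]) (auto simp: C \<Phi>)
    then show ?thesis
      by (rule holomorphic_many_cong[OF _ op subset_refl]) (auto simp: C \<Phi> pr inj inv_into_prod_chart)
  next
    assume pr: "pr = snd"
    have "holomorphic_many (\<lambda>z. f (inv_into W \<psi> (vec_right z))) (\<Phi> ` (U \<times> U \<inter> C))"
      by (rule holomorphic_many_compose_linear[OF hol_ring_carrierD(2)[OF f VW(2)]
            bounded_linear_vec_right vec_right_smult]) (auto simp: C \<Phi>)
    then show ?thesis
      by (rule holomorphic_many_cong[OF _ op subset_refl]) (auto simp: C \<Phi> pr inj inv_into_prod_chart)
  qed
qed simp

section \<open>Germs\<close>

text \<open>Functoriality of restriction carries the whole calculus of germs. Algebraic operations
  are kept out, so that it applies alike to \<open>diag_quotient\<close>, to a presheaf of modules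
  and to its presheaf of jets.\<close>

locale section_presheaf =
  fixes X :: "'a topology" and F :: "('a, 's, ('s, 'e) ring_scheme) presheaf"
  assumes restr_closed: "\<lbrakk>openin X U; openin X V; V \<subseteq> U; s \<in> carrier (sect F U)\<rbrakk> \<Longrightarrow>
      restr F U V s \<in> carrier (sect F V)"
    and restr_restr: "\<lbrakk>openin X U; openin X V; openin X W; W \<subseteq> V; V \<subseteq> U; s \<in> carrier (sect F U)\<rbrakk> \<Longrightarrow>
      restr F V W (restr F U V s) = restr F U W s"
begin

lemma germ_self: "\<lbrakk>openin X U; x \<in> U; s \<in> carrier (sect F U)\<rbrakk> \<Longrightarrow> (U, s) \<in> germ X F x U s"
  unfolding germ_def by auto

lemma germ_memD:
  assumes "(V, t) \<in> germ X F x U s"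
  obtains W where "openin X V" "x \<in> V" "t \<in> carrier (sect F V)" "openin X W" "x \<in> W"
    "W \<subseteq> U" "W \<subseteq> V" "restr F U W s = restr F V W t"
  using assms unfolding germ_def by auto

text \<open>Agreement near \<open>x\<close> is transitive: the two witnessing neighbourhoods are
  replaced by their intersection.\<close>

lemma germ_mono:
  assumes UV: "openin X U" "openin X V" "s \<in> carrier (sect F U)" "t \<in> carrier (sect F V)"
    and W: "openin X W" "x \<in> W" "W \<subseteq> U" "W \<subseteq> V" and eq: "restr F U W s = restr F V W t"
  shows "germ X F x U s \<subseteq> germ X F x V t"
proof clarify
  fix V' t' assume "(V', t') \<in> germ X F x U s"
  then obtain W' where V': "openin X V'" "x \<in> V'" "t' \<in> carrier (sect F V')"
    and W': "openin X W'" "x \<in> W'" "W' \<subseteq> U" "W' \<subseteq> V'" and eq': "restr F U W' s = restr F V' W' t'"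
    by (rule germ_memD)
  let ?W = "W \<inter> W'"
  have o: "openin X ?W" using W W' by auto
  have "restr F V ?W t = restr F W ?W (restr F V W t)"
    using UV W o by (simp add: restr_restr)
  also have "\<dots> = restr F U ?W s" using UV W o by (simp add: restr_restr flip: eq)
  also have "\<dots> = restr F W' ?W (restr F U W' s)" using UV W' o by (simp add: restr_restr)
  also have "\<dots> = restr F V' ?W t'" using UV V' W' o by (simp add: restr_restr eq')
  finally show "(V', t') \<in> germ X F x V t"
    using V' W W' o unfolding germ_def by (auto intro!: exI[of _ ?W])
qed

lemma germ_eqI:
  assumes "openin X U" "openin X V" "s \<in> carrier (sect F U)" "t \<in> carrier (sect F V)"
    "openin X W" "x \<in> W" "W \<subseteq> U" "W \<subseteq> V" "restr F U W s = restr F V W t"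
  shows "germ X F x U s = germ X F x V t"
  using germ_mono[OF assms] germ_mono[OF assms(2,1,4,3,5,6,8,7) assms(9)[symmetric]] by blast

lemma germ_restr:
  assumes "openin X U" "openin X V" "V \<subseteq> U" "x \<in> V" "s \<in> carrier (sect F U)"
  shows "germ X F x V (restr F U V s) = germ X F x U s"
  by (rule germ_eqI[of _ _ _ _ V]) (use assms in \<open>auto simp: restr_closed restr_restr\<close>)

lemma inverse_image_sections_restrict:
  assumes "openin Y U" "openin Y V" "V \<subseteq> U" "s \<in> inverse_image_sections Y X f F U"
  shows "restrict s V \<in> inverse_image_sections Y X f F V"
  unfolding inverse_image_sections_def
proof (intro CollectI conjI ballI)
  fix x assume x: "x \<in> V"
  with assms(3,4) obtain S W q where *: "openin Y S" "x \<in> S" "openin X W" "f ` S \<subseteq> W"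
    "q \<in> carrier (sect F W)" "\<forall>y\<in>S. s y = germ X F (f y) W q"
    unfolding inverse_image_sections_def by blast
  then show "\<exists>S W q. openin Y S \<and> x \<in> S \<and> S \<subseteq> V \<and> openin X W \<and> f ` S \<subseteq> W \<and>
      q \<in> carrier (sect F W) \<and> (\<forall>y\<in>S. restrict s V y = germ X F (f y) W q)"
    using x assms(2) by (intro exI[of _ "S \<inter> V"] exI[of _ W] exI[of _ q]) auto
qed simp

lemma inverse_image_sections_germ:
  assumes "openin Y U" "openin X W" "f ` U \<subseteq> W" "q \<in> carrier (sect F W)"
  shows "(\<lambda>x\<in>U. germ X F (f x) W q) \<in> inverse_image_sections Y X f F U"
  unfolding inverse_image_sections_def using assms
  by (auto intro!: exI[of _ U] exI[of _ W] exI[of _ q])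

text \<open>\<open>stalk_op\<close> combines representatives over one and the same open set, so the
  two local sections are first restricted to \<open>W \<inter> W'\<close>.\<close>

lemma inverse_image_sections_common:
  assumes "s \<in> inverse_image_sections Y X f F U" "t \<in> inverse_image_sections Y X f F U" "x \<in> U"
  obtains V W q r where "openin Y V" "x \<in> V" "V \<subseteq> U" "openin X W" "f ` V \<subseteq> W"
    "q \<in> carrier (sect F W)" "r \<in> carrier (sect F W)"
    "\<And>y. y \<in> V \<Longrightarrow> s y = germ X F (f y) W q" "\<And>y. y \<in> V \<Longrightarrow> t y = germ X F (f y) W r"
proof -
  from assms(1,3) obtain V W q where q: "openin Y V" "x \<in> V" "V \<subseteq> U" "openin X W" "f ` V \<subseteq> W"
    "q \<in> carrier (sect F W)" "\<forall>y\<in>V. s y = germ X F (f y) W q"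
    unfolding inverse_image_sections_def by blast
  from assms(2,3) obtain V' W' r where r: "openin Y V'" "x \<in> V'" "openin X W'" "f ` V' \<subseteq> W'"
    "r \<in> carrier (sect F W')" "\<forall>y\<in>V'. t y = germ X F (f y) W' r"
    unfolding inverse_image_sections_def by blast
  have o: "openin X (W \<inter> W')" "openin Y (V \<inter> V')" using q r by auto
  have f: "f y \<in> W \<inter> W'" if "y \<in> V \<inter> V'" for y using that q r by auto
  show thesis
  proof (rule that)
    show "restr F W (W \<inter> W') q \<in> carrier (sect F (W \<inter> W'))"
      "restr F W' (W \<inter> W') r \<in> carrier (sect F (W \<inter> W'))"
      using q r o by (auto intro: restr_closed)
    show "s y = germ X F (f y) (W \<inter> W') (restr F W (W \<inter> W') q)" if "y \<in> V \<inter> V'" for y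
      using that f q o by (simp add: germ_restr)
    show "t y = germ X F (f y) (W \<inter> W') (restr F W' (W \<inter> W') r)" if "y \<in> V \<inter> V'" for y
      using that f r o by (simp add: germ_restr)
  qed (use q r o f in auto)
qed

context
  fixes op :: "'a set \<Rightarrow> 's \<Rightarrow> 's \<Rightarrow> 's"
  assumes op_closed: "\<And>U s t. \<lbrakk>openin X U; s \<in> carrier (sect F U); t \<in> carrier (sect F U)\<rbrakk> \<Longrightarrow>
      op U s t \<in> carrier (sect F U)"
    and op_restr: "\<And>U V s t. \<lbrakk>openin X U; openin X V; V \<subseteq> U; s \<in> carrier (sect F U);
        t \<in> carrier (sect F U)\<rbrakk> \<Longrightarrow> restr F U V (op U s t) = op V (restr F U V s) (restr F U V t)"
begin

text \<open>The union in \<open>stalk_op\<close> has a single distinct member: any other pair of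
  representatives agrees with \<open>s\<close> and \<open>t\<close> on a smaller neighbourhood, and
  \<open>op\<close> commutes with restriction to it.\<close>

lemma stalk_op_germ:
  assumes "openin X U" "x \<in> U" "s \<in> carrier (sect F U)" "t \<in> carrier (sect F U)"
  shows "stalk_op X F op x (germ X F x U s) (germ X F x U t) = germ X F x U (op U s t)"
proof -
  have "germ X F x V (op V s' t') = germ X F x U (op U s t)"
    if s': "(V, s') \<in> germ X F x U s" and t': "(V, t') \<in> germ X F x U t" for V s' t'
  proof -
    from s' obtain W where V: "openin X V" "s' \<in> carrier (sect F V)" "openin X W" "x \<in> W"
      "W \<subseteq> U" "W \<subseteq> V" "restr F U W s = restr F V W s'"
      by (rule germ_memD)
    from t' obtain W' where W': "t' \<in> carrier (sect F V)" "openin X W'" "x \<in> W'"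
      "W' \<subseteq> U" "W' \<subseteq> V" "restr F U W' t = restr F V W' t'"
      by (rule germ_memD)
    let ?W = "W \<inter> W'"
    have o: "openin X ?W" using V W' by auto
    have "restr F V ?W s' = restr F U ?W s"
      using V W' o assms
      by (metis Int_lower1 restr_restr)
    moreover have "restr F V ?W t' = restr F U ?W t"
      using V W' o assms
      by (metis Int_lower2 restr_restr)
    moreover have "restr F V ?W (op V s' t') = op ?W (restr F V ?W s') (restr F V ?W t')"
      by (rule op_restr) (use V W' o in auto)
    moreover have "restr F U ?W (op U s t) = op ?W (restr F U ?W s) (restr F U ?W t)"
      by (rule op_restr) (use V W' o assms in auto)
    ultimately show ?thesis
      using V W' o assms by (intro germ_eqI[of _ _ _ _ ?W]) (auto intro: op_closed)
  qed
  moreover have "(U, s) \<in> germ X F x U s" "(U, t) \<in> germ X F x U t"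
    using assms by (auto intro: germ_self)
  ultimately show ?thesis unfolding stalk_op_def by blast
qed

lemma inverse_image_sections_op_closed:
  assumes "s \<in> inverse_image_sections Y X f F U" "t \<in> inverse_image_sections Y X f F U"
  shows "(\<lambda>x\<in>U. stalk_op X F op (f x) (s x) (t x)) \<in> inverse_image_sections Y X f F U"
  unfolding inverse_image_sections_def
proof (intro CollectI conjI ballI)
  fix x assume x: "x \<in> U"
  obtain V W q r where *: "openin Y V" "x \<in> V" "V \<subseteq> U" "openin X W" "f ` V \<subseteq> W"
    "q \<in> carrier (sect F W)" "r \<in> carrier (sect F W)"
    "\<And>y. y \<in> V \<Longrightarrow> s y = germ X F (f y) W q" "\<And>y. y \<in> V \<Longrightarrow> t y = germ X F (f y) W r"
    using inverse_image_sections_common[OF assms x] by metis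
  then show "\<exists>V W q. openin Y V \<and> x \<in> V \<and> V \<subseteq> U \<and> openin X W \<and> f ` V \<subseteq> W \<and> q \<in> carrier (sect F W) \<and>
      (\<forall>y\<in>V. (\<lambda>x\<in>U. stalk_op X F op (f x) (s x) (t x)) y = germ X F (f y) W q)"
    by (intro exI[of _ V] exI[of _ W] exI[of _ "op W q r"])
       (auto simp: op_closed stalk_op_germ subset_iff image_subset_iff)
qed simp

end

end

section \<open>The structure presheaf of the first infinitesimal neighbourhood\<close>

abbreviation diag_class ::
  "('a, 'n::finite) chart set \<Rightarrow> ('a \<times> 'a) set \<Rightarrow> ('a \<times> 'a \<Rightarrow> complex) \<Rightarrow> ('a \<times> 'a \<Rightarrow> complex) set" where
  "diag_class A W h \<equiv> diag_ideal_sq A W +>\<^bsub>hol_ring (prod_atlas A A) W\<^esub> h"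

lemma diag_quotient_simps:
  "carrier (sect (diag_quotient A) W) = diag_class A W ` carrier (hol_ring (prod_atlas A A) W)"
  "add (sect (diag_quotient A) W) = set_add (hol_ring (prod_atlas A A) W)"
  "monoid.mult (sect (diag_quotient A) W) =
     rcoset_mult (hol_ring (prod_atlas A A) W) (diag_ideal_sq A W)"
  by (auto simp: diag_quotient_def FactRing_def A_RCOSETS_def' a_r_coset_def' image_def)

lemma diag_class_memE:
  assumes "h' \<in> diag_class A W h"
  obtains j where "j \<in> diag_ideal_sq A W" "h' = (\<lambda>x\<in>W. j x + h x)"
  using assms by (auto simp: a_r_coset_def')

locale charted_space =
  fixes X :: "'a topology" and A :: "('a, 'n::finite) chart set"
  assumes open_charts: "open_charts X A"
begin

abbreviation "XX \<equiv> prod_topology X X"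
abbreviation "AA \<equiv> prod_atlas A A"

lemma open_charts_AA: "open_charts XX AA"
  by (rule open_charts_prod[OF open_charts open_charts])

lemma cring_AA: "openin XX W \<Longrightarrow> cring (hol_ring AA W)"
  by (rule hol_ring_cring[OF open_charts_AA])

lemma ideal_diag_ideal:
  assumes W: "openin XX W"
  shows "ideal (diag_ideal A W) (hol_ring AA W)"
proof -
  interpret cring "hol_ring AA W" by (rule cring_AA[OF W])
  note closed = hol_ring_const_closed[OF open_charts_AA W] hol_ring_add_closed[OF open_charts_AA W]
    hol_ring_mult_closed[OF open_charts_AA W] hol_ring_uminus_closed[OF open_charts_AA W]
  show ?thesis
  proof (rule idealI)
    show "subgroup (diag_ideal A W) (add_monoid (hol_ring AA W))"
    proof
      fix f assume f: "f \<in> diag_ideal A W"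
      then have "f \<in> carrier (hol_ring AA W)" by (simp add: diag_ideal_def)
      then have "\<ominus>\<^bsub>hol_ring AA W\<^esub> f = (\<lambda>x\<in>W. - f x)"
        by (intro minus_equality) (auto simp: closed intro!: restrict_ext)
      moreover have "(\<lambda>x\<in>W. - f x) \<in> diag_ideal A W"
        using f by (auto simp: diag_ideal_def closed)
      ultimately show "inv\<^bsub>add_monoid (hol_ring AA W)\<^esub> f \<in> diag_ideal A W"
        unfolding a_inv_def by simp
    qed (auto simp: diag_ideal_def closed)
  qed (auto simp: ring_axioms diag_ideal_def closed)
qed

lemma ideal_diag_ideal_sq: "openin XX W \<Longrightarrow> ideal (diag_ideal_sq A W) (hol_ring AA W)"
  unfolding diag_ideal_sq_def
  by (intro ring.ideal_prod_is_ideal ideal_diag_ideal cring.axioms(1) cring_AA)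

text \<open>The square is generated by products and sums, both formed pointwise and hence compatible
  with restriction. This makes restriction of classes well defined.\<close>

lemma diag_ideal_sq_restrict:
  assumes "openin XX W" "openin XX W'" "W' \<subseteq> W" "j \<in> diag_ideal_sq A W"
  shows "restrict j W' \<in> diag_ideal_sq A W'"
  using assms(4) unfolding diag_ideal_sq_def
proof (induction rule: ideal_prod.induct)
  case (prod i j)
  then have "restrict i W' \<otimes>\<^bsub>hol_ring AA W'\<^esub> restrict j W' \<in> diag_ideal A W' \<cdot>\<^bsub>hol_ring AA W'\<^esub> diag_ideal A W'"
    using assms(3) hol_ring_restrict[OF open_charts_AA assms(2,3)]
    by (intro ideal_prod.prod) (auto simp: diag_ideal_def)
  moreover have "restrict i W' \<otimes>\<^bsub>hol_ring AA W'\<^esub> restrict j W' = restrict (i \<otimes>\<^bsub>hol_ring AA W\<^esub> j) W'"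
    using assms(3) by (auto simp: fun_eq_iff)
  ultimately show ?case by (simp only:)
next
  case (sum i j)
  have "restrict i W' \<oplus>\<^bsub>hol_ring AA W'\<^esub> restrict j W' = restrict (i \<oplus>\<^bsub>hol_ring AA W\<^esub> j) W'"
    using assms(3) by (auto simp: fun_eq_iff)
  then show ?case using ideal_prod.sum[OF sum.IH] by (simp only:)
qed

lemma diag_class_self:
  assumes W: "openin XX W" and h: "h \<in> carrier (hol_ring AA W)"
  shows "h \<in> diag_class A W h"
proof -
  interpret ideal "diag_ideal_sq A W" "hol_ring AA W" by (rule ideal_diag_ideal_sq[OF W])
  show ?thesis using a_rcos_self[OF h] .
qed

lemma diag_class_eqI:
  assumes W: "openin XX W" and h: "h \<in> carrier (hol_ring AA W)" and h': "h' \<in> diag_class A W h"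
  shows "diag_class A W h' = diag_class A W h"
proof -
  interpret ideal "diag_ideal_sq A W" "hol_ring AA W" by (rule ideal_diag_ideal_sq[OF W])
  show ?thesis using a_repr_independence'[OF h' h] by simp
qed

text \<open>Restriction in \<open>diag_quotient\<close> is a union over all members of a class;
  members differ by the squared ideal, which restricts into the squared ideal, so the union is over
  a constant family.\<close>

lemma diag_quotient_restr:
  assumes W: "openin XX W" "openin XX W'" "W' \<subseteq> W" and h: "h \<in> carrier (hol_ring AA W)"
  shows "restr (diag_quotient A) W W' (diag_class A W h) = diag_class A W' (restrict h W')"
proof -
  have "diag_class A W' (restrict f W') = diag_class A W' (restrict h W')"
    if "f \<in> diag_class A W h" for f
  proof (rule diag_class_eqI[OF W(2)])
    show "restrict h W' \<in> carrier (hol_ring AA W')"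
      using hol_ring_restrict[OF open_charts_AA W(2,3) h] .
    from that obtain j where j: "j \<in> diag_ideal_sq A W" "f = (\<lambda>x\<in>W. j x + h x)"
      by (rule diag_class_memE)
    have "restrict f W' = restrict j W' \<oplus>\<^bsub>hol_ring AA W'\<^esub> restrict h W'"
      using j W(3) by (auto simp: fun_eq_iff)
    then show "restrict f W' \<in> diag_class A W' (restrict h W')"
      using diag_ideal_sq_restrict[OF W j(1)] unfolding a_r_coset_def' by blast
  qed
  moreover have "diag_class A W h \<noteq> {}" using diag_class_self[OF W(1) h] by blast
  ultimately have "(\<Union>f\<in>diag_class A W h. diag_class A W' (restrict f W')) = diag_class A W' (restrict h W')"
    by (intro SUP_eq_const) blast+
  then show ?thesis by (simp add: diag_quotient_def)
qed

lemma diag_quotient_add: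
  assumes W: "openin XX W" and "h \<in> carrier (hol_ring AA W)" "h' \<in> carrier (hol_ring AA W)"
  shows "diag_class A W h \<oplus>\<^bsub>sect (diag_quotient A) W\<^esub> diag_class A W h' = diag_class A W (\<lambda>x\<in>W. h x + h' x)"
proof -
  interpret ideal "diag_ideal_sq A W" "hol_ring AA W" by (rule ideal_diag_ideal_sq[OF W])
  interpret abelian_subgroup "diag_ideal_sq A W" "hol_ring AA W"
    by (rule abelian_subgroupI3[OF is_additive_subgroup is_abelian_group])
  show ?thesis using a_rcos_sum[OF assms(2,3)] by (simp add: diag_quotient_simps)
qed

lemma diag_quotient_mult:
  assumes W: "openin XX W" and "h \<in> carrier (hol_ring AA W)" "h' \<in> carrier (hol_ring AA W)"
  shows "diag_class A W h \<otimes>\<^bsub>sect (diag_quotient A) W\<^esub> diag_class A W h' = diag_class A W (\<lambda>x\<in>W. h x * h' x)"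
proof -
  interpret ideal "diag_ideal_sq A W" "hol_ring AA W" by (rule ideal_diag_ideal_sq[OF W])
  show ?thesis using rcoset_mult_add[OF assms(2,3)] by (simp add: diag_quotient_simps)
qed

sublocale Q: section_presheaf XX "diag_quotient A"
proof
  fix U V s assume *: "openin XX U" "openin XX V" "V \<subseteq> U" "s \<in> carrier (sect (diag_quotient A) U)"
  then show "restr (diag_quotient A) U V s \<in> carrier (sect (diag_quotient A) V)"
    using hol_ring_restrict[OF open_charts_AA *(2,3)] by (auto simp: diag_quotient_simps diag_quotient_restr)
next
  fix U V W s assume *: "openin XX U" "openin XX V" "openin XX W" "W \<subseteq> V" "V \<subseteq> U"
    "s \<in> carrier (sect (diag_quotient A) U)"
  then have "restrict (restrict f V) W = restrict f W" for f :: "'a \<times> 'a \<Rightarrow> complex"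
    by (auto simp: fun_eq_iff)
  then show "restr (diag_quotient A) V W (restr (diag_quotient A) U V s) = restr (diag_quotient A) U W s"
    using * hol_ring_restrict[OF open_charts_AA *(2,5)]
    by (auto simp: diag_quotient_simps diag_quotient_restr)
qed

lemma diag_quotient_add_closed:
  assumes "openin XX U" "s \<in> carrier (sect (diag_quotient A) U)" "t \<in> carrier (sect (diag_quotient A) U)"
  shows "s \<oplus>\<^bsub>sect (diag_quotient A) U\<^esub> t \<in> carrier (sect (diag_quotient A) U)"
  using assms(2,3) hol_ring_add_closed[OF open_charts_AA assms(1)]
  unfolding diag_quotient_simps(1) by (auto simp: diag_quotient_add[OF assms(1)])

lemma diag_quotient_mult_closed:
  assumes "openin XX U" "s \<in> carrier (sect (diag_quotient A) U)" "t \<in> carrier (sect (diag_quotient A) U)"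
  shows "s \<otimes>\<^bsub>sect (diag_quotient A) U\<^esub> t \<in> carrier (sect (diag_quotient A) U)"
  using assms(2,3) hol_ring_mult_closed[OF open_charts_AA assms(1)]
  unfolding diag_quotient_simps(1) by (auto simp: diag_quotient_mult[OF assms(1)])

lemma diag_quotient_add_restr:
  assumes "openin XX U" "openin XX V" "V \<subseteq> U" "s \<in> carrier (sect (diag_quotient A) U)"
    "t \<in> carrier (sect (diag_quotient A) U)"
  shows "restr (diag_quotient A) U V (s \<oplus>\<^bsub>sect (diag_quotient A) U\<^esub> t) =
    restr (diag_quotient A) U V s \<oplus>\<^bsub>sect (diag_quotient A) V\<^esub> restr (diag_quotient A) U V t"
proof -
  from assms(4,5) obtain h k where hk: "h \<in> carrier (hol_ring AA U)" "k \<in> carrier (hol_ring AA U)"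
    "s = diag_class A U h" "t = diag_class A U k" unfolding diag_quotient_simps by auto
  have "restrict (\<lambda>x\<in>U. h x + k x) V = (\<lambda>x\<in>V. restrict h V x + restrict k V x)"
    using assms(3) by (auto simp: fun_eq_iff)
  then show ?thesis
    using assms(1-3) hk hol_ring_restrict[OF open_charts_AA assms(2,3)]
      hol_ring_add_closed[OF open_charts_AA assms(1)]
    by (simp add: diag_quotient_restr diag_quotient_add)
qed

lemma diag_quotient_mult_restr:
  assumes "openin XX U" "openin XX V" "V \<subseteq> U" "s \<in> carrier (sect (diag_quotient A) U)"
    "t \<in> carrier (sect (diag_quotient A) U)"
  shows "restr (diag_quotient A) U V (s \<otimes>\<^bsub>sect (diag_quotient A) U\<^esub> t) =
    restr (diag_quotient A) U V s \<otimes>\<^bsub>sect (diag_quotient A) V\<^esub> restr (diag_quotient A) U V t"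
proof -
  from assms(4,5) obtain h k where hk: "h \<in> carrier (hol_ring AA U)" "k \<in> carrier (hol_ring AA U)"
    "s = diag_class A U h" "t = diag_class A U k" unfolding diag_quotient_simps by auto
  have "restrict (\<lambda>x\<in>U. h x * k x) V = (\<lambda>x\<in>V. restrict h V x * restrict k V x)"
    using assms(3) by (auto simp: fun_eq_iff)
  then show ?thesis
    using assms(1-3) hk hol_ring_restrict[OF open_charts_AA assms(2,3)]
      hol_ring_mult_closed[OF open_charts_AA assms(1)]
    by (simp add: diag_quotient_restr diag_quotient_mult)
qed

lemma stalk_add_germ:
  assumes "openin XX U" "x \<in> U" "s \<in> carrier (sect (diag_quotient A) U)"
    "t \<in> carrier (sect (diag_quotient A) U)"
  shows "stalk_op XX (diag_quotient A) (\<lambda>W. add (sect (diag_quotient A) W)) x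
      (germ XX (diag_quotient A) x U s) (germ XX (diag_quotient A) x U t) =
    germ XX (diag_quotient A) x U (s \<oplus>\<^bsub>sect (diag_quotient A) U\<^esub> t)"
  by (rule Q.stalk_op_germ) (simp_all add: assms diag_quotient_add_closed diag_quotient_add_restr)

lemma sections_add_closed:
  assumes "s \<in> inverse_image_sections Y XX f (diag_quotient A) U"
    "t \<in> inverse_image_sections Y XX f (diag_quotient A) U"
  shows "(\<lambda>x\<in>U. stalk_op XX (diag_quotient A) (\<lambda>W. add (sect (diag_quotient A) W)) (f x) (s x) (t x))
    \<in> inverse_image_sections Y XX f (diag_quotient A) U"
  by (rule Q.inverse_image_sections_op_closed) (simp_all add: assms diag_quotient_add_closed diag_quotient_add_restr)

lemma stalk_mult_germ:
  assumes "openin XX U" "x \<in> U" "s \<in> carrier (sect (diag_quotient A) U)"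
    "t \<in> carrier (sect (diag_quotient A) U)"
  shows "stalk_op XX (diag_quotient A) (\<lambda>W. monoid.mult (sect (diag_quotient A) W)) x
      (germ XX (diag_quotient A) x U s) (germ XX (diag_quotient A) x U t) =
    germ XX (diag_quotient A) x U (s \<otimes>\<^bsub>sect (diag_quotient A) U\<^esub> t)"
  by (rule Q.stalk_op_germ) (simp_all add: assms diag_quotient_mult_closed diag_quotient_mult_restr)

lemma sections_mult_closed:
  assumes "s \<in> inverse_image_sections Y XX f (diag_quotient A) U"
    "t \<in> inverse_image_sections Y XX f (diag_quotient A) U"
  shows "(\<lambda>x\<in>U. stalk_op XX (diag_quotient A) (\<lambda>W. monoid.mult (sect (diag_quotient A) W)) (f x) (s x) (t x))
    \<in> inverse_image_sections Y XX f (diag_quotient A) U"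
  by (rule Q.inverse_image_sections_op_closed) (simp_all add: assms diag_quotient_mult_closed diag_quotient_mult_restr)

end

lemma nbhd_sheaf_simps [simp]:
  "carrier (sect (nbhd_sheaf X A) U) =
     inverse_image_sections X (prod_topology X X) diag (diag_quotient A) U"
  "a \<otimes>\<^bsub>sect (nbhd_sheaf X A) U\<^esub> b = (\<lambda>x\<in>U. stalk_op (prod_topology X X) (diag_quotient A)
     (\<lambda>W. monoid.mult (sect (diag_quotient A) W)) (diag x) (a x) (b x))"
  "a \<oplus>\<^bsub>sect (nbhd_sheaf X A) U\<^esub> b = (\<lambda>x\<in>U. stalk_op (prod_topology X X) (diag_quotient A)
     (\<lambda>W. add (sect (diag_quotient A) W)) (diag x) (a x) (b x))"
  "restr (nbhd_sheaf X A) U V a = restrict a V"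
  by (simp_all add: nbhd_sheaf_def inverse_image_ring_def)

lemma mk_module_simps [simp]:
  "carrier (mk_module C z p m) = C" "add (mk_module C z p m) = p" "smult (mk_module C z p m) = m"
  "ring.zero (mk_module C z p m) = z"
  by (simp_all add: mk_module_def)

text \<open>Unspecified unless \<open>l\<close> takes the same value at all representatives of the germ.\<close>

definition germ_value ::
  "(('a \<times> 'a \<Rightarrow> complex) \<Rightarrow> complex) \<Rightarrow> ('a \<times> 'a, ('a \<times> 'a \<Rightarrow> complex) set) germ \<Rightarrow> complex" where
  "germ_value l g = the_elem {l h | h W c. (W, c) \<in> g \<and> h \<in> c}"

lemma nbhd_restrict_eq: "x \<in> U \<Longrightarrow> nbhd_restrict U a x = germ_value (\<lambda>h. h (diag x)) (a x)"
  by (simp add: nbhd_restrict_def germ_value_def)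

section \<open>Pullbacks to the infinitesimal neighbourhood and its module structure\<close>

context charted_space
begin

abbreviation "nbhd_sections U \<equiv> inverse_image_sections X XX diag (diag_quotient A) U"

lemma openin_square: "openin X U \<Longrightarrow> openin XX (U \<times> U)"
  by (simp add: openin_prod_Times_iff)

lemma nbhd_pullback_closed:
  assumes "openin X U" "pr = fst \<or> pr = snd" "f \<in> carrier (hol_ring A U)"
  shows "nbhd_pullback X A pr U f \<in> nbhd_sections U"
  unfolding nbhd_pullback_def
  by (intro Q.inverse_image_sections_germ assms openin_square)
     (use hol_ring_pullback[OF open_charts assms] in \<open>auto simp: diag_def diag_quotient_simps\<close>)

text \<open>Needed for restriction of jets: scalars enter the tensor relations through their
  pullbacks, so these must restrict along with the sections.\<close>

lemma nbhd_pullback_restrict: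
  assumes U: "openin X U" "openin X V" "V \<subseteq> U" and pr: "pr = fst \<or> pr = snd"
    and f: "f \<in> carrier (hol_ring A U)"
  shows "restrict (nbhd_pullback X A pr U f) V = nbhd_pullback X A pr V (restrict f V)"
proof
  fix x
  note h = hol_ring_pullback[OF open_charts U(1) pr f]
  note o = openin_square[OF U(1)] openin_square[OF U(2)]
  have VU: "V \<times> V \<subseteq> U \<times> U" using U(3) by auto
  have "restrict (\<lambda>z\<in>U \<times> U. f (pr z)) (V \<times> V) = (\<lambda>z\<in>V \<times> V. restrict f V (pr z))"
    using pr VU by (auto simp: fun_eq_iff)
  then have "restr (diag_quotient A) (U \<times> U) (V \<times> V) (diag_class A (U \<times> U) (\<lambda>z\<in>U \<times> U. f (pr z)))
      = diag_class A (V \<times> V) (\<lambda>z\<in>V \<times> V. restrict f V (pr z))"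
    using diag_quotient_restr[OF o VU h] by simp
  then have "germ XX (diag_quotient A) (diag x) (V \<times> V) (diag_class A (V \<times> V) (\<lambda>z\<in>V \<times> V. restrict f V (pr z)))
      = germ XX (diag_quotient A) (diag x) (U \<times> U) (diag_class A (U \<times> U) (\<lambda>z\<in>U \<times> U. f (pr z)))"
    if "x \<in> V"
    using Q.germ_restr[OF o VU, of "diag x" "diag_class A (U \<times> U) (\<lambda>z\<in>U \<times> U. f (pr z))"] that h
    by (simp add: diag_def diag_quotient_simps)
  then show "restrict (nbhd_pullback X A pr U f) V x = nbhd_pullback X A pr V (restrict f V) x"
    using U(3) by (auto simp: nbhd_pullback_def)
qed

lemma nbhd_module_smult_closed:
  assumes "openin X U" "f \<in> carrier (hol_ring A U)" "a \<in> nbhd_sections U"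
  shows "f \<odot>\<^bsub>nbhd_module X A U\<^esub> a \<in> nbhd_sections U"
  using sections_mult_closed[OF nbhd_pullback_closed[OF assms(1) _ assms(2), of snd] assms(3)]
  by (simp add: nbhd_module_def)

lemma nbhd_module_add_closed:
  assumes "a \<in> nbhd_sections U" "b \<in> nbhd_sections U"
  shows "a \<oplus>\<^bsub>nbhd_module X A U\<^esub> b \<in> nbhd_sections U"
  using sections_add_closed[OF assms] by (simp add: nbhd_module_def)

lemma nbhd_module_add_restrict:
  assumes "V \<subseteq> U"
  shows "restrict (a \<oplus>\<^bsub>nbhd_module X A U\<^esub> b) V = restrict a V \<oplus>\<^bsub>nbhd_module X A V\<^esub> restrict b V"
  using assms by (auto simp: nbhd_module_def fun_eq_iff)

lemma nbhd_module_smult_restrict: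
  assumes "openin X U" "openin X V" "V \<subseteq> U" "f \<in> carrier (hol_ring A U)"
  shows "restrict (f \<odot>\<^bsub>nbhd_module X A U\<^esub> a) V = restrict f V \<odot>\<^bsub>nbhd_module X A V\<^esub> restrict a V"
  using assms(3)
  by (auto simp: nbhd_module_def fun_eq_iff simp flip: nbhd_pullback_restrict[OF assms(1-3) _ assms(4)])

subsection \<open>Functionals on germs along the diagonal\<close>

text \<open>An additive functional on the stalk of the quotient sheaf at \<open>diag p\<close>,
  encoded on representatives: locality and vanishing on the squared ideal are what its descent to
  germs requires.\<close>

definition jet_functional :: "'a \<Rightarrow> (('a \<times> 'a \<Rightarrow> complex) \<Rightarrow> complex) \<Rightarrow> bool" where
  "jet_functional p l \<longleftrightarrow>
     (\<forall>W W' h. openin XX W \<longrightarrow> openin XX W' \<longrightarrow> W' \<subseteq> W \<longrightarrow> diag p \<in> W' \<longrightarrow>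
        h \<in> carrier (hol_ring AA W) \<longrightarrow> l (restrict h W') = l h) \<and>
     (\<forall>W h h'. openin XX W \<longrightarrow> diag p \<in> W \<longrightarrow> h \<in> carrier (hol_ring AA W) \<longrightarrow>
        h' \<in> carrier (hol_ring AA W) \<longrightarrow> l (\<lambda>x\<in>W. h x + h' x) = l h + l h') \<and>
     (\<forall>W j. openin XX W \<longrightarrow> diag p \<in> W \<longrightarrow> j \<in> diag_ideal_sq A W \<longrightarrow> l j = 0)"

lemma jet_functional_restrict:
  "\<lbrakk>jet_functional p l; openin XX W; openin XX W'; W' \<subseteq> W; diag p \<in> W'; h \<in> carrier (hol_ring AA W)\<rbrakk>
    \<Longrightarrow> l (restrict h W') = l h"
  and jet_functional_add:
  "\<lbrakk>jet_functional p l; openin XX W; diag p \<in> W; h \<in> carrier (hol_ring AA W); k \<in> carrier (hol_ring AA W)\<rbrakk>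
    \<Longrightarrow> l (\<lambda>x\<in>W. h x + k x) = l h + l k"
  and jet_functional_sq:
  "\<lbrakk>jet_functional p l; openin XX W; diag p \<in> W; j \<in> diag_ideal_sq A W\<rbrakk> \<Longrightarrow> l j = 0"
  unfolding jet_functional_def by simp_all

lemma jet_functional_class:
  assumes l: "jet_functional p l" and W: "openin XX W" "diag p \<in> W"
    and h: "h \<in> carrier (hol_ring AA W)" and h': "h' \<in> diag_class A W h"
  shows "l h' = l h"
proof -
  from h' obtain j where j: "j \<in> diag_ideal_sq A W" "h' = (\<lambda>x\<in>W. j x + h x)"
    by (rule diag_class_memE)
  interpret ideal "diag_ideal_sq A W" "hol_ring AA W" by (rule ideal_diag_ideal_sq[OF W(1)])
  show ?thesis
    using jet_functional_add[OF l W Icarr[OF j(1)] h] jet_functional_sq[OF l W j(1)] j(2) by simp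
qed

text \<open>The set inside \<open>germ_value\<close> is a singleton. Representatives
  \<open>h\<close> and \<open>k\<close> have the same class over a common \<open>W'\<close>, and
  \<open>l\<close> ignores both the restriction to \<open>W'\<close> and the squared ideal.\<close>

lemma germ_value_germ:
  assumes l: "jet_functional p l" and W: "openin XX W" "diag p \<in> W"
    and h: "h \<in> carrier (hol_ring AA W)"
  shows "germ_value l (germ XX (diag_quotient A) (diag p) W (diag_class A W h)) = l h"
proof -
  let ?g = "germ XX (diag_quotient A) (diag p) W (diag_class A W h)"
  have "l h' = l h" if "(V, c) \<in> ?g" "h' \<in> c" for V c h'
    using that(1)
  proof (rule Q.germ_memD)
    fix W' assume V: "openin XX V" "diag p \<in> V" "c \<in> carrier (sect (diag_quotient A) V)"
      and W': "openin XX W'" "diag p \<in> W'" "W' \<subseteq> W" "W' \<subseteq> V"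
      and eq: "restr (diag_quotient A) W W' (diag_class A W h) = restr (diag_quotient A) V W' c"
    from V(3) obtain k where k: "k \<in> carrier (hol_ring AA V)" "c = diag_class A V k"
      by (auto simp: diag_quotient_simps)
    note c = hol_ring_restrict[OF open_charts_AA W'(1,3) h] hol_ring_restrict[OF open_charts_AA W'(1,4) k(1)]
    have "diag_class A W' (restrict h W') = diag_class A W' (restrict k W')"
      using eq W' V W h k by (simp add: diag_quotient_restr)
    then have "restrict h W' \<in> diag_class A W' (restrict k W')"
      using diag_class_self[OF W'(1) c(1)] by simp
    then have "l (restrict h W') = l (restrict k W')"
      using jet_functional_class[OF l W'(1,2) c(2)] by simp
    moreover have "l (restrict h W') = l h" "l (restrict k W') = l k"
      using jet_functional_restrict[OF l W(1) W'(1,3,2) h] jet_functional_restrict[OF l V(1) W'(1,4,2) k(1)]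
      by simp_all
    moreover have "l h' = l k"
      using jet_functional_class[OF l V(1,2) k(1)] that(2) k(2) by simp
    ultimately show ?thesis by simp
  qed
  moreover have "(W, diag_class A W h) \<in> ?g"
    using W h by (intro Q.germ_self) (auto simp: diag_quotient_simps)
  ultimately have "{l h' | h' V c. (V, c) \<in> ?g \<and> h' \<in> c} = {l h}"
    using diag_class_self[OF W(1) h] by blast
  then show ?thesis by (simp add: germ_value_def)
qed

lemma nbhd_sections_common:
  assumes "a \<in> nbhd_sections U" "b \<in> nbhd_sections U" "p \<in> U"
  obtains W h k where "openin XX W" "diag p \<in> W" "h \<in> carrier (hol_ring AA W)" "k \<in> carrier (hol_ring AA W)"
    "a p = germ XX (diag_quotient A) (diag p) W (diag_class A W h)"
    "b p = germ XX (diag_quotient A) (diag p) W (diag_class A W k)"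
proof -
  obtain V W q r where *: "p \<in> V" "openin XX W" "diag ` V \<subseteq> W"
    "q \<in> carrier (sect (diag_quotient A) W)" "r \<in> carrier (sect (diag_quotient A) W)"
    "\<And>y. y \<in> V \<Longrightarrow> a y = germ XX (diag_quotient A) (diag y) W q"
    "\<And>y. y \<in> V \<Longrightarrow> b y = germ XX (diag_quotient A) (diag y) W r"
    using Q.inverse_image_sections_common[OF assms] by metis
  then obtain h k where "h \<in> carrier (hol_ring AA W)" "k \<in> carrier (hol_ring AA W)"
    "q = diag_class A W h" "r = diag_class A W k"
    by (auto simp: diag_quotient_simps)
  with * show thesis by (intro that[of W h k]) auto
qed

lemma germ_value_add:
  assumes l: "jet_functional p l" and ab: "a \<in> nbhd_sections U" "b \<in> nbhd_sections U" and p: "p \<in> U"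
  shows "germ_value l ((a \<oplus>\<^bsub>nbhd_module X A U\<^esub> b) p) = germ_value l (a p) + germ_value l (b p)"
proof -
  obtain W h k where *: "openin XX W" "diag p \<in> W" "h \<in> carrier (hol_ring AA W)" "k \<in> carrier (hol_ring AA W)"
    "a p = germ XX (diag_quotient A) (diag p) W (diag_class A W h)"
    "b p = germ XX (diag_quotient A) (diag p) W (diag_class A W k)"
    using nbhd_sections_common[OF ab p] by metis
  have "(a \<oplus>\<^bsub>nbhd_module X A U\<^esub> b) p =
      germ XX (diag_quotient A) (diag p) W (diag_class A W (\<lambda>x\<in>W. h x + k x))"
    using * p by (simp add: nbhd_module_def stalk_add_germ diag_quotient_simps(1) diag_quotient_add)
  moreover have "l (\<lambda>x\<in>W. h x + k x) = l h + l k"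
    using jet_functional_add[OF l *(1-4)] .
  ultimately show ?thesis
    using * hol_ring_add_closed[OF open_charts_AA *(1)] by (simp add: germ_value_germ[OF l])
qed

text \<open>The functional is quantified after \<open>h\<close> and \<open>k\<close> are chosen,
  because the Leibniz rule needs evaluation and derivative of the same representatives.\<close>

lemma nbhd_mult_representatives:
  assumes ab: "a \<in> nbhd_sections U" "b \<in> nbhd_sections U" and p: "p \<in> U"
  obtains W h k where "openin XX W" "diag p \<in> W" "h \<in> carrier (hol_ring AA W)" "k \<in> carrier (hol_ring AA W)"
    "\<forall>l. jet_functional p l \<longrightarrow> germ_value l (a p) = l h \<and> germ_value l (b p) = l k \<and>
       germ_value l ((a \<otimes>\<^bsub>sect (nbhd_sheaf X A) U\<^esub> b) p) = l (\<lambda>x\<in>W. h x * k x)"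
proof -
  obtain W h k where *: "openin XX W" "diag p \<in> W" "h \<in> carrier (hol_ring AA W)" "k \<in> carrier (hol_ring AA W)"
    "a p = germ XX (diag_quotient A) (diag p) W (diag_class A W h)"
    "b p = germ XX (diag_quotient A) (diag p) W (diag_class A W k)"
    using nbhd_sections_common[OF ab p] by metis
  have "(a \<otimes>\<^bsub>sect (nbhd_sheaf X A) U\<^esub> b) p =
      germ XX (diag_quotient A) (diag p) W (diag_class A W (\<lambda>x\<in>W. h x * k x))"
    using * p by (simp add: stalk_mult_germ diag_quotient_simps(1) diag_quotient_mult)
  with * hol_ring_mult_closed[OF open_charts_AA *(1)] show thesis
    by (intro that[of W h k]) (simp_all add: germ_value_germ)
qed

lemma germ_value_pullback:
  assumes "jet_functional p l" "openin X U" "p \<in> U" "pr = fst \<or> pr = snd" "f \<in> carrier (hol_ring A U)"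
  shows "germ_value l (nbhd_pullback X A pr U f p) = l (\<lambda>z\<in>U \<times> U. f (pr z))"
  using germ_value_germ[OF assms(1) openin_square[OF assms(2)] _ hol_ring_pullback[OF open_charts assms(2,4,5)]] assms(3)
  by (simp add: nbhd_pullback_def diag_def)

text \<open>Beyond plain induction on the ideal product, the sum case supplies that both summands
  are holomorphic, which differentiation of the sum relies on.\<close>

lemma diag_ideal_sq_induct [consumes 2, case_names prod sum]:
  assumes W: "openin XX W" and j: "j \<in> diag_ideal_sq A W"
    and prod: "\<And>f g. \<lbrakk>f \<in> carrier (hol_ring AA W); g \<in> carrier (hol_ring AA W);
        \<And>x. diag x \<in> W \<Longrightarrow> f (diag x) = 0; \<And>x. diag x \<in> W \<Longrightarrow> g (diag x) = 0\<rbrakk> \<Longrightarrow> P (\<lambda>x\<in>W. f x * g x)"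
    and sum: "\<And>f g. \<lbrakk>f \<in> carrier (hol_ring AA W); g \<in> carrier (hol_ring AA W); P f; P g\<rbrakk> \<Longrightarrow> P (\<lambda>x\<in>W. f x + g x)"
  shows "P j"
  using j unfolding diag_ideal_sq_def
proof (induction rule: ideal_prod.induct)
  case (prod f g)
  then have "P (\<lambda>x\<in>W. f x * g x)" by (intro assms(3)) (auto simp: diag_ideal_def)
  then show ?case by (simp only: hol_ring_simps)
next
  case (sum f g)
  interpret ideal "diag_ideal_sq A W" "hol_ring AA W" by (rule ideal_diag_ideal_sq[OF W])
  have "P (\<lambda>x\<in>W. f x + g x)"
    using sum Icarr unfolding diag_ideal_sq_def by (intro assms(4)) auto
  then show ?case by (simp only: hol_ring_simps)
qed

lemma jet_functional_eval: "jet_functional p (\<lambda>h. h (diag p))"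
  unfolding jet_functional_def
proof (intro conjI allI impI)
  fix W j assume W: "openin XX W" "diag p \<in> W" "j \<in> diag_ideal_sq A W"
  from W(1,3) show "j (diag p) = 0" using W(2) by (induction rule: diag_ideal_sq_induct) auto
qed auto

end

section \<open>Differentiation along a coordinate line through the point\<close>

definition chart_curve :: "'a set \<Rightarrow> ('a \<Rightarrow> complex ^ 'n::finite) \<Rightarrow> 'n \<Rightarrow> 'a \<Rightarrow> complex \<Rightarrow> 'a" where
  "chart_curve U \<phi> i p t = inv_into U \<phi> (\<phi> p + t *s axis i 1)"

text \<open>A partial derivative at \<open>(p, p)\<close> in the first variable only. Freezing the
  second variable at \<open>p\<close> makes it blind to pullbacks along \<open>snd\<close>.\<close>

definition jet_deriv ::
  "'a set \<Rightarrow> ('a \<Rightarrow> complex ^ 'n::finite) \<Rightarrow> 'n \<Rightarrow> 'a \<Rightarrow> ('a \<times> 'a \<Rightarrow> complex) \<Rightarrow> complex" where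
  "jet_deriv U \<phi> i p h = deriv (\<lambda>t. h (chart_curve U \<phi> i p t, p)) 0"

locale chart_point = charted_space X A
  for X :: "'a topology" and A :: "('a, 'n::finite) chart set" +
  fixes U0 :: "'a set" and \<phi> :: "'a \<Rightarrow> complex ^ 'n" and i :: 'n and p :: 'a
  assumes chart: "(U0, \<phi>) \<in> A" and p: "p \<in> U0"
begin

abbreviation "curve \<equiv> chart_curve U0 \<phi> i p"
abbreviation "\<delta> \<equiv> jet_deriv U0 \<phi> i p"

lemma curve_0 [simp]: "curve 0 = p"
  using inv_into_f_f[OF open_charts_inj[OF open_charts chart] p] by (simp add: chart_curve_def)

text \<open>\<open>inv_into\<close> is controlled only on the image of the chart, so the curve has
  its intended meaning only for parameters near 0; derivatives at 0 see no more than that.\<close>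

lemma eventually_curve:
  assumes "openin X V" "p \<in> V"
  shows "\<forall>\<^sub>F t in nhds 0. curve t \<in> V \<and> curve t \<in> U0 \<and> \<phi> (curve t) = \<phi> p + t *s axis i 1"
proof -
  let ?S = "(\<lambda>t. \<phi> p + t *s axis i 1) -` \<phi> ` (V \<inter> U0)"
  have "bounded_linear (\<lambda>t::complex. t *s (axis i 1 :: complex ^ 'n))"
    by (intro linear_conv_bounded_linear[THEN iffD1] linearI) (simp_all add: vec_eq_iff distrib_right)
  then have "isCont (\<lambda>t::complex. \<phi> p + t *s axis i 1) t" for t
    by (rule continuous_add[OF continuous_const linear_continuous_at])
  then have "open ?S"
    by (rule continuous_open_vimage[OF open_charts_open[OF open_charts chart assms(1)]])
  moreover have "0 \<in> ?S" using p assms(2) by auto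
  moreover have "curve t \<in> V \<and> curve t \<in> U0 \<and> \<phi> (curve t) = \<phi> p + t *s axis i 1" if "t \<in> ?S" for t
    using that inv_into_f_f[OF open_charts_inj[OF open_charts chart]] by (auto simp: chart_curve_def)
  ultimately show ?thesis unfolding eventually_nhds by blast
qed

lemma eventually_curve_prod:
  assumes "openin XX W" "diag p \<in> W"
  shows "\<forall>\<^sub>F t in nhds 0. (curve t, p) \<in> W"
proof -
  from assms obtain S T where ST: "openin X S" "p \<in> S" "p \<in> T" "S \<times> T \<subseteq> W"
    unfolding openin_prod_topology_alt diag_def by meson
  from eventually_curve[OF ST(1,2)] show ?thesis
    by (rule eventually_mono) (use ST in auto)
qed

text \<open>In the product of the chart with itself, the path \<open>(curve t, p)\<close> is a
  straight line with direction \<open>axis i 1\<close> in the first block and 0 in the second, so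
  \<open>holomorphic_many_along_line\<close> applies.\<close>

lemma curve_differentiable:
  assumes W: "openin XX W" "diag p \<in> W" and h: "h \<in> carrier (hol_ring AA W)"
  shows "(\<lambda>t. h (curve t, p)) field_differentiable at 0"
proof -
  note inj = open_charts_inj[OF open_charts chart]
  let ?\<Phi> = "\<lambda>(x, y). vec_append (\<phi> x) (\<phi> y)"
  have C: "(U0 \<times> U0, ?\<Phi>) \<in> AA"
    using chart unfolding prod_atlas_def by (auto simp flip: prod_chart_eq)
  have z: "vec_append (\<phi> p) (\<phi> p) \<in> ?\<Phi> ` (W \<inter> U0 \<times> U0)"
    using W(2) p by (force simp: diag_def)
  let ?g = "\<lambda>z. h (inv_into (U0 \<times> U0) ?\<Phi> z)"
  have fd: "(\<lambda>t. ?g (vec_append (\<phi> p) (\<phi> p) + t *s vec_append (axis i 1) 0)) field_differentiable at 0"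
    by (rule holomorphic_many_along_line[OF hol_ring_carrierD(2)[OF h C] z])
  have "p \<in> topspace X" using openin_subset[OF W(1)] W(2) by (auto simp: diag_def)
  from eventually_curve[OF openin_topspace this]
  have ev: "\<forall>\<^sub>F t in nhds 0. ?g (vec_append (\<phi> p) (\<phi> p) + t *s vec_append (axis i 1) 0) = h (curve t, p)"
  proof (rule eventually_mono)
    fix t assume t: "curve t \<in> topspace X \<and> curve t \<in> U0 \<and> \<phi> (curve t) = \<phi> p + t *s axis i 1"
    have "vec_append (\<phi> p) (\<phi> p) + t *s vec_append (axis i 1) 0 = vec_append (\<phi> (curve t)) (\<phi> p)"
      using t by (auto simp: vec_eq_iff vec_append_def split: sum.split)
    then show "?g (vec_append (\<phi> p) (\<phi> p) + t *s vec_append (axis i 1) 0) = h (curve t, p)"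
      using t p inv_into_prod_chart[OF inj inj, of "curve t" p] by simp
  qed
  from fd show ?thesis
    unfolding field_differentiable_def DERIV_cong_ev[OF refl ev refl] .
qed

lemma jet_deriv_cong:
  assumes "openin XX W" "diag p \<in> W" "\<And>z. z \<in> W \<Longrightarrow> h z = k z"
  shows "\<delta> h = \<delta> k"
  unfolding jet_deriv_def
  by (rule deriv_cong_ev)
     (use eventually_mono[OF eventually_curve_prod[OF assms(1,2)]] assms(3) in auto)

lemma jet_deriv_mult:
  assumes W: "openin XX W" "diag p \<in> W" "h \<in> carrier (hol_ring AA W)" "k \<in> carrier (hol_ring AA W)"
  shows "\<delta> (\<lambda>x\<in>W. h x * k x) = h (diag p) * \<delta> k + \<delta> h * k (diag p)"
proof -
  have "\<delta> (\<lambda>x\<in>W. h x * k x) = \<delta> (\<lambda>x. h x * k x)"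
    by (rule jet_deriv_cong[OF W(1,2)]) auto
  then show ?thesis
    using deriv_mult[OF curve_differentiable[OF W(1,2,3)] curve_differentiable[OF W(1,2,4)]]
    by (simp add: jet_deriv_def diag_def)
qed

lemma jet_functional_deriv: "jet_functional p \<delta>"
  unfolding jet_functional_def
proof (intro conjI allI impI)
  fix W W' h assume "openin XX W'" "diag p \<in> W'"
  then show "\<delta> (restrict h W') = \<delta> h" by (rule jet_deriv_cong) auto
next
  fix W h k assume W: "openin XX W" "diag p \<in> W" "h \<in> carrier (hol_ring AA W)" "k \<in> carrier (hol_ring AA W)"
  have "\<delta> (\<lambda>x\<in>W. h x + k x) = \<delta> (\<lambda>x. h x + k x)"
    by (rule jet_deriv_cong[OF W(1,2)]) auto
  then show "\<delta> (\<lambda>x\<in>W. h x + k x) = \<delta> h + \<delta> k"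
    using deriv_add[OF curve_differentiable[OF W(1,2,3)] curve_differentiable[OF W(1,2,4)]]
    by (simp add: jet_deriv_def)
next
  fix W j assume W: "openin XX W" "diag p \<in> W" "j \<in> diag_ideal_sq A W"
  from W(1,3) show "\<delta> j = 0"
  proof (induction rule: diag_ideal_sq_induct)
    \<comment> \<open>Both factors vanish at \<open>diag p\<close>, so each term of the Leibniz rule
      contains a zero factor.\<close>
    case (prod f g)
    then show ?case using jet_deriv_mult[OF W(1,2) prod(1,2)] W(2) by (simp only: mult_zero_left mult_zero_right add_0)
  next
    case (sum f g)
    have "\<delta> (\<lambda>x\<in>W. f x + g x) = \<delta> (\<lambda>x. f x + g x)"
      by (rule jet_deriv_cong[OF W(1,2)]) auto
    then show ?case
      using deriv_add[OF curve_differentiable[OF W(1,2) sum(1)] curve_differentiable[OF W(1,2) sum(2)]] sum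
      by (simp add: jet_deriv_def)
  qed
qed

end

section \<open>Tensor products\<close>

text \<open>The additive extension of \<open>g\<close> from generators to the free abelian group,
  with complex values; \<open>frag_extend\<close> only takes values in another free abelian
  group.\<close>

definition frag_sum :: "('k \<Rightarrow> complex) \<Rightarrow> ('k \<Rightarrow>\<^sub>0 int) \<Rightarrow> complex" where
  "frag_sum g c = (\<Sum>k\<in>Poly_Mapping.keys c. of_int (Poly_Mapping.lookup c k) * g k)"

lemma frag_sum_superset:
  assumes "finite S" "Poly_Mapping.keys c \<subseteq> S"
  shows "frag_sum g c = (\<Sum>k\<in>S. of_int (Poly_Mapping.lookup c k) * g k)"
  unfolding frag_sum_def
  by (rule sum.mono_neutral_left[OF assms]) (simp add: in_keys_iff)

lemma frag_sum_add: "frag_sum g (b + c) = frag_sum g b + frag_sum g c"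
proof -
  let ?S = "Poly_Mapping.keys b \<union> Poly_Mapping.keys c"
  have "finite ?S" "Poly_Mapping.keys (b + c) \<subseteq> ?S" by (auto simp: keys_add)
  then show ?thesis
    by (simp add: frag_sum_superset[of ?S] lookup_add distrib_right sum.distrib)
qed

lemma frag_sum_zero [simp]: "frag_sum g 0 = 0"
  by (simp add: frag_sum_def)

lemma frag_sum_of [simp]: "frag_sum g (frag_of k) = g k"
  by (simp add: frag_sum_def)

lemma frag_sum_uminus: "frag_sum g (- c) = - frag_sum g c"
  using frag_sum_add[of g c "- c"] by (simp add: eq_neg_iff_add_eq_0 add.commute)

lemma frag_sum_diff: "frag_sum g (b - c) = frag_sum g b - frag_sum g c"
  using frag_sum_add[of g b "- c"] by (simp add: frag_sum_uminus)

lemma frag_sum_extend: "frag_sum g (frag_extend (\<lambda>k. frag_of (\<sigma> k)) c) = frag_sum (\<lambda>k. g (\<sigma> k)) c"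
proof -
  have "Poly_Mapping.keys c \<subseteq> UNIV" by simp
  then show ?thesis
    by (induction c rule: frag_induction) (auto simp: frag_extend_diff frag_sum_diff)
qed

text \<open>Keeps the tensor relations supported on pairs of carrier elements; on such elements the
  inverse in \<open>free_Abelian_group\<close> is ordinary negation.\<close>

definition module_closed :: "('r, 'e) ring_scheme \<Rightarrow> ('r, 'm) module \<Rightarrow> bool" where
  "module_closed R M \<longleftrightarrow> (\<forall>x\<in>carrier M. \<forall>y\<in>carrier M. x \<oplus>\<^bsub>M\<^esub> y \<in> carrier M) \<and>
     (\<forall>r\<in>carrier R. \<forall>x\<in>carrier M. r \<odot>\<^bsub>M\<^esub> x \<in> carrier M)"

lemma keys_diff_subset: "Poly_Mapping.keys b \<subseteq> S \<Longrightarrow> Poly_Mapping.keys c \<subseteq> S \<Longrightarrow> Poly_Mapping.keys (b - c :: 'k \<Rightarrow>\<^sub>0 int) \<subseteq> S"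
  using keys_diff[of b c] by blast

context
  fixes R :: "('r, 'e) ring_scheme" and M :: "('r, 'm) module" and N :: "('r, 'n) module"
  assumes M: "module_closed R M" and N: "module_closed R N"
begin

lemma keys_tensor_relations:
  assumes "c \<in> tensor_relations R M N"
  shows "Poly_Mapping.keys c \<subseteq> carrier M \<times> carrier N"
  using assms M N unfolding tensor_relations_def module_closed_def
  by (elim UnE CollectE exE conjE) (simp_all add: keys_diff_subset)

text \<open>The set \<open>K\<close> plays the part of a subgroup, so checking generators is enough.
  Its three uses take \<open>K\<close> to be zero (functionals), the null group of another tensor
  product (maps), and the elements with admissible support.\<close>

lemma tensor_null_image:
  fixes H :: "('m \<times> 'n \<Rightarrow>\<^sub>0 int) \<Rightarrow> 'z::ab_group_add"
  assumes H: "\<And>b c. H (b + c) = H b + H c"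
    and K: "0 \<in> K" "\<And>x y. x \<in> K \<Longrightarrow> y \<in> K \<Longrightarrow> x + y \<in> K" "\<And>x. x \<in> K \<Longrightarrow> - x \<in> K"
    and rel: "\<And>c. c \<in> tensor_relations R M N \<Longrightarrow> H c \<in> K"
    and c: "c \<in> tensor_null R M N"
  shows "H c \<in> K"
proof -
  have H0: "H 0 = 0" using H[of 0 0] by simp
  have Hm: "H (- b) = - H b" for b using H[of b "- b"] H0 by (simp add: eq_neg_iff_add_eq_0 add.commute)
  show ?thesis
    using c unfolding tensor_null_def
    by (induction rule: generate.induct) (auto simp: H H0 Hm K rel keys_tensor_relations)
qed

lemma tensor_null_zero: "0 \<in> tensor_null R M N"
  unfolding tensor_null_def using generate.one[of "free_Abelian_group (carrier M \<times> carrier N)"] by simp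

lemma tensor_null_add: "b \<in> tensor_null R M N \<Longrightarrow> c \<in> tensor_null R M N \<Longrightarrow> b + c \<in> tensor_null R M N"
  unfolding tensor_null_def using generate.eng[of _ "free_Abelian_group (carrier M \<times> carrier N)"] by simp

lemma tensor_null_relation: "c \<in> tensor_relations R M N \<Longrightarrow> c \<in> tensor_null R M N"
  unfolding tensor_null_def by (rule generate.incl)

lemma tensor_null_uminus: "c \<in> tensor_null R M N \<Longrightarrow> - c \<in> tensor_null R M N"
  unfolding tensor_null_def
proof (induction rule: generate.induct)
  case (incl c)
  then show ?case using generate.inv[OF incl, of "free_Abelian_group (carrier M \<times> carrier N)"]
    by (simp add: keys_tensor_relations)
next
  case (inv c)
  then show ?case by (simp add: keys_tensor_relations generate.incl)
next
  case (eng b c)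
  from generate.eng[OF eng.IH] show ?case by (simp add: algebra_simps)
qed (use generate.one[of "free_Abelian_group (carrier M \<times> carrier N)"] in simp)

lemma keys_tensor_null:
  "c \<in> tensor_null R M N \<Longrightarrow> Poly_Mapping.keys c \<subseteq> carrier M \<times> carrier N"
  using tensor_null_image[of "\<lambda>c. c" "{c. Poly_Mapping.keys c \<subseteq> carrier M \<times> carrier N}" c]
  by (auto simp: keys_tensor_relations dest: subsetD[OF keys_add])

end

lemma tensor_group_carrierE:
  assumes "T \<in> carrier (tensor_group R M N)"
  obtains c where "Poly_Mapping.keys c \<subseteq> carrier M \<times> carrier N"
    "T = tensor_null R M N #>\<^bsub>free_Abelian_group (carrier M \<times> carrier N)\<^esub> c"
  using assms unfolding tensor_group_def FactGroup_def RCOSETS_def by auto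

lemma tensor_group_carrierI:
  "Poly_Mapping.keys c \<subseteq> carrier M \<times> carrier N \<Longrightarrow>
    tensor_null R M N #>\<^bsub>free_Abelian_group (carrier M \<times> carrier N)\<^esub> c \<in> carrier (tensor_group R M N)"
  unfolding tensor_group_def FactGroup_def RCOSETS_def by auto

lemma frag_coset: "H #>\<^bsub>free_Abelian_group S\<^esub> c = (\<lambda>n. n + c) ` H"
  unfolding r_coset_def by auto

lemma tensor_class_self: "c \<in> tensor_null R M N #>\<^bsub>free_Abelian_group S\<^esub> c"
  using generate.one[of "free_Abelian_group (carrier M \<times> carrier N)" "tensor_relations R M N"]
  by (force simp: frag_coset tensor_null_def)

section \<open>Maps between tensor products\<close>

abbreviation tensor_hom :: "('k \<Rightarrow> 'm) \<Rightarrow> ('l \<Rightarrow> 'n) \<Rightarrow> ('k \<times> 'l \<Rightarrow>\<^sub>0 int) \<Rightarrow> ('m \<times> 'n \<Rightarrow>\<^sub>0 int)" where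
  "tensor_hom \<phi> \<psi> \<equiv> frag_extend (\<lambda>(m, n). frag_of (\<phi> m, \<psi> n))"

lemma frag_sum_tensor_hom: "frag_sum g (tensor_hom \<phi> \<psi> c) = frag_sum (\<lambda>(m, n). g (\<phi> m, \<psi> n)) c"
  using frag_sum_extend[of g "\<lambda>(m, n). (\<phi> m, \<psi> n)" c] by (simp add: case_prod_unfold)

lemma keys_tensor_hom:
  assumes "Poly_Mapping.keys c \<subseteq> S \<times> T" "\<phi> ` S \<subseteq> S'" "\<psi> ` T \<subseteq> T'"
  shows "Poly_Mapping.keys (tensor_hom \<phi> \<psi> c) \<subseteq> S' \<times> T'"
proof -
  have "Poly_Mapping.keys (tensor_hom \<phi> \<psi> c) \<subseteq>
      (\<Union>k\<in>Poly_Mapping.keys c. Poly_Mapping.keys (case k of (m, n) \<Rightarrow> frag_of (\<phi> m, \<psi> n)))"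
    by (rule keys_frag_extend)
  also have "\<dots> \<subseteq> S' \<times> T'" using assms by (fastforce simp: keys_frag_of)
  finally show ?thesis .
qed

lemma tensor_hom_cong:
  assumes "Poly_Mapping.keys c \<subseteq> S \<times> T" "\<And>x. x \<in> S \<Longrightarrow> \<phi> x = \<phi>' x" "\<And>y. y \<in> T \<Longrightarrow> \<psi> y = \<psi>' y"
  shows "tensor_hom \<phi> \<psi> c = tensor_hom \<phi>' \<psi>' c"
  using assms by (intro frag_extend_eq) (auto dest!: subsetD)

lemma tensor_hom_tensor_hom:
  "tensor_hom \<phi>' \<psi>' (tensor_hom \<phi> \<psi> c) = tensor_hom (\<lambda>x. \<phi>' (\<phi> x)) (\<lambda>y. \<psi>' (\<psi> y)) c"
proof -
  have "Poly_Mapping.keys c \<subseteq> UNIV" by simp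
  then show ?thesis
    by (induction c rule: frag_induction) (auto simp: frag_extend_diff)
qed

text \<open>Each kind of relation goes to a relation of the same kind. The maps are semilinear over
  \<open>\<theta>\<close> because passing from \<open>U\<close> to a smaller open set also changes
  the ring of functions.\<close>

lemma tensor_hom_null:
  assumes closed: "module_closed R M" "module_closed R N" "module_closed R' M'" "module_closed R' N'"
    and \<theta>: "\<And>r. r \<in> carrier R \<Longrightarrow> \<theta> r \<in> carrier R'"
    and \<phi>: "\<And>x. x \<in> carrier M \<Longrightarrow> \<phi> x \<in> carrier M'"
      "\<And>x y. x \<in> carrier M \<Longrightarrow> y \<in> carrier M \<Longrightarrow> \<phi> (x \<oplus>\<^bsub>M\<^esub> y) = \<phi> x \<oplus>\<^bsub>M'\<^esub> \<phi> y"
      "\<And>r x. r \<in> carrier R \<Longrightarrow> x \<in> carrier M \<Longrightarrow> \<phi> (r \<odot>\<^bsub>M\<^esub> x) = \<theta> r \<odot>\<^bsub>M'\<^esub> \<phi> x"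
    and \<psi>: "\<And>x. x \<in> carrier N \<Longrightarrow> \<psi> x \<in> carrier N'"
      "\<And>x y. x \<in> carrier N \<Longrightarrow> y \<in> carrier N \<Longrightarrow> \<psi> (x \<oplus>\<^bsub>N\<^esub> y) = \<psi> x \<oplus>\<^bsub>N'\<^esub> \<psi> y"
      "\<And>r x. r \<in> carrier R \<Longrightarrow> x \<in> carrier N \<Longrightarrow> \<psi> (r \<odot>\<^bsub>N\<^esub> x) = \<theta> r \<odot>\<^bsub>N'\<^esub> \<psi> x"
    and c: "c \<in> tensor_null R M N"
  shows "tensor_hom \<phi> \<psi> c \<in> tensor_null R' M' N'"
proof (rule tensor_null_image[OF closed(1,2) _ _ _ _ _ c])
  show "0 \<in> tensor_null R' M' N'" by (rule tensor_null_zero[OF closed(3,4)])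
  show "\<And>x y. x \<in> tensor_null R' M' N' \<Longrightarrow> y \<in> tensor_null R' M' N' \<Longrightarrow> x + y \<in> tensor_null R' M' N'"
    by (rule tensor_null_add[OF closed(3,4)])
  show "\<And>x. x \<in> tensor_null R' M' N' \<Longrightarrow> - x \<in> tensor_null R' M' N'"
    by (rule tensor_null_uminus[OF closed(3,4)])
  fix b assume "b \<in> tensor_relations R M N"
  then consider
    (left) m m' n where "b = frag_of (m \<oplus>\<^bsub>M\<^esub> m', n) - frag_of (m, n) - frag_of (m', n)"
      "m \<in> carrier M" "m' \<in> carrier M" "n \<in> carrier N"
    | (right) m n n' where "b = frag_of (m, n \<oplus>\<^bsub>N\<^esub> n') - frag_of (m, n) - frag_of (m, n')"
      "m \<in> carrier M" "n \<in> carrier N" "n' \<in> carrier N"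
    | (scalar) r m n where "b = frag_of (r \<odot>\<^bsub>M\<^esub> m, n) - frag_of (m, r \<odot>\<^bsub>N\<^esub> n)"
      "r \<in> carrier R" "m \<in> carrier M" "n \<in> carrier N"
    unfolding tensor_relations_def by blast
  then have "tensor_hom \<phi> \<psi> b \<in> tensor_relations R' M' N'"
  proof cases
    case left
    then show ?thesis unfolding tensor_relations_def
      by (intro UnI1 CollectI exI[of _ "\<phi> m"] exI[of _ "\<phi> m'"] exI[of _ "\<psi> n"])
         (simp add: frag_extend_diff \<phi> \<psi>)
  next
    case right
    then show ?thesis unfolding tensor_relations_def
      by (intro UnI1[OF UnI2] CollectI exI[of _ "\<phi> m"] exI[of _ "\<psi> n"] exI[of _ "\<psi> n'"])
         (simp add: frag_extend_diff \<phi> \<psi>)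
  next
    case scalar
    then show ?thesis unfolding tensor_relations_def
      by (intro UnI2 CollectI exI[of _ "\<theta> r"] exI[of _ "\<phi> m"] exI[of _ "\<psi> n"])
         (simp add: frag_extend_diff \<phi> \<psi> \<theta>)
  qed
  then show "tensor_hom \<phi> \<psi> b \<in> tensor_null R' M' N'" by (rule tensor_null_relation[OF closed(3,4)])
qed (rule frag_extend_add)

text \<open>Once null elements map to null elements, every representative yields the same target
  coset, so the union in \<open>tensor_map\<close> collapses.\<close>

lemma tensor_map_class:
  assumes closed: "module_closed R' M'" "module_closed R' N'"
    and null: "\<And>c. c \<in> tensor_null R M N \<Longrightarrow> tensor_hom \<phi> \<psi> c \<in> tensor_null R' M' N'"
  shows "tensor_map R' M' N' \<phi> \<psi> (tensor_null R M N #>\<^bsub>free_Abelian_group (carrier M \<times> carrier N)\<^esub> c) =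
    tensor_null R' M' N' #>\<^bsub>free_Abelian_group (carrier M' \<times> carrier N')\<^esub> tensor_hom \<phi> \<psi> c" (is "?L = ?R")
proof
  show "?L \<subseteq> ?R"
    unfolding tensor_map_def frag_coset
  proof clarify
    fix n n' assume n: "n \<in> tensor_null R M N" "n' \<in> tensor_null R' M' N'"
    have "n' + tensor_hom \<phi> \<psi> (n + c) = (n' + tensor_hom \<phi> \<psi> n) + tensor_hom \<phi> \<psi> c"
      by (simp add: frag_extend_add add.assoc)
    then show "n' + tensor_hom \<phi> \<psi> (n + c) \<in> (\<lambda>n. n + tensor_hom \<phi> \<psi> c) ` tensor_null R' M' N'"
      using tensor_null_add[OF closed n(2) null[OF n(1)]] by blast
  qed
  show "?R \<subseteq> ?L"
    unfolding tensor_map_def by (rule UN_upper[OF tensor_class_self])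
qed

section \<open>First jets\<close>

locale presheaf_of_modules = charted_space X A + section_presheaf X F
  for X :: "'a topology" and A :: "('a, 'n::finite) chart set"
    and F :: "('a, 'a \<Rightarrow> complex, 's) module_presheaf" +
  assumes sect_closed: "openin X U \<Longrightarrow> module_closed (hol_ring A U) (sect F U)"
    and restr_add: "\<lbrakk>openin X U; openin X V; V \<subseteq> U; s \<in> carrier (sect F U); t \<in> carrier (sect F U)\<rbrakk> \<Longrightarrow>
      restr F U V (s \<oplus>\<^bsub>sect F U\<^esub> t) = restr F U V s \<oplus>\<^bsub>sect F V\<^esub> restr F U V t"
    and restr_smult: "\<lbrakk>openin X U; openin X V; V \<subseteq> U; f \<in> carrier (hol_ring A U); s \<in> carrier (sect F U)\<rbrakk> \<Longrightarrow>
      restr F U V (f \<odot>\<^bsub>sect F U\<^esub> s) = restrict f V \<odot>\<^bsub>sect F V\<^esub> restr F U V s"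
begin

abbreviation "jets \<equiv> jet_presheaf X A F"
abbreviation "jet_null U \<equiv> tensor_null (hol_ring A U) (nbhd_module X A U) (sect F U)"
abbreviation "jet_class U c \<equiv>
  jet_null U #>\<^bsub>free_Abelian_group (nbhd_sections U \<times> carrier (sect F U))\<^esub> c"

lemma carrier_nbhd_module: "carrier (nbhd_module X A U) = nbhd_sections U"
  by (simp add: nbhd_module_def)

lemma nbhd_module_closed: "openin X U \<Longrightarrow> module_closed (hol_ring A U) (nbhd_module X A U)"
  by (simp add: module_closed_def carrier_nbhd_module nbhd_module_smult_closed nbhd_module_add_closed)

lemma jets_carrierE:
  assumes "t \<in> carrier (sect jets U)"
  obtains c where "Poly_Mapping.keys c \<subseteq> nbhd_sections U \<times> carrier (sect F U)" "t = jet_class U c"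
  using assms by (auto simp: jet_presheaf_def Let_def carrier_nbhd_module elim!: tensor_group_carrierE)

lemma jets_carrierI:
  "Poly_Mapping.keys c \<subseteq> nbhd_sections U \<times> carrier (sect F U) \<Longrightarrow> jet_class U c \<in> carrier (sect jets U)"
  using tensor_group_carrierI[of c "nbhd_module X A U" "sect F U" "hol_ring A U"]
  by (simp add: jet_presheaf_def Let_def carrier_nbhd_module)

lemma keys_jets:
  assumes U: "openin X U" and t: "t \<in> carrier (sect jets U)" and c: "c \<in> t"
  shows "Poly_Mapping.keys c \<subseteq> nbhd_sections U \<times> carrier (sect F U)"
proof -
  obtain b where b: "Poly_Mapping.keys b \<subseteq> nbhd_sections U \<times> carrier (sect F U)" "t = jet_class U b"
    using t by (rule jets_carrierE)
  with c obtain n where n: "n \<in> jet_null U" "c = n + b" by (auto simp: frag_coset)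
  show ?thesis
    using keys_tensor_null[OF nbhd_module_closed[OF U] sect_closed[OF U] n(1)] b(1) n(2) keys_add[of n b]
    by (auto simp: carrier_nbhd_module)
qed

lemma jets_restr:
  assumes U: "openin X U" "openin X V" "V \<subseteq> U"
  shows "restr jets U V (jet_class U c) = jet_class V (tensor_hom (\<lambda>a. restrict a V) (restr F U V) c)"
proof -
  have null: "tensor_hom (\<lambda>a. restrict a V) (restr F U V) n \<in> jet_null V" if n: "n \<in> jet_null U" for n
  proof (rule tensor_hom_null[OF nbhd_module_closed[OF U(1)] sect_closed[OF U(1)]
        nbhd_module_closed[OF U(2)] sect_closed[OF U(2)] _ _ _ _ _ _ _ n])
    show "restrict r V \<in> carrier (hol_ring A V)" if "r \<in> carrier (hol_ring A U)" for r
      using hol_ring_restrict[OF open_charts U(2,3) that] .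
  qed (use U in \<open>auto simp: carrier_nbhd_module Q.inverse_image_sections_restrict nbhd_module_add_restrict
      nbhd_module_smult_restrict restr_closed restr_add restr_smult\<close>)
  have "restr (nbhd_sheaf X A) U V = (\<lambda>a. restrict a V)" by (simp add: fun_eq_iff)
  then show ?thesis
    using tensor_map_class[where R = "hol_ring A U" and M = "nbhd_module X A U" and N = "sect F U",
        OF nbhd_module_closed[OF U(2)] sect_closed[OF U(2)] null, of c]
    by (simp add: jet_presheaf_def carrier_nbhd_module)
qed

sublocale jets: section_presheaf X jets
proof
  fix U V t assume U: "openin X U" "openin X V" "V \<subseteq> U" and t: "t \<in> carrier (sect jets U)"
  from t obtain c where c: "Poly_Mapping.keys c \<subseteq> nbhd_sections U \<times> carrier (sect F U)" "t = jet_class U c"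
    by (rule jets_carrierE)
  have "Poly_Mapping.keys (tensor_hom (\<lambda>a. restrict a V) (restr F U V) c) \<subseteq> nbhd_sections V \<times> carrier (sect F V)"
    by (rule keys_tensor_hom[OF c(1)]) (use U in \<open>auto simp: Q.inverse_image_sections_restrict restr_closed\<close>)
  then show "restr jets U V t \<in> carrier (sect jets V)"
    unfolding c(2) jets_restr[OF U] by (rule jets_carrierI)
next
  fix U V W t assume U: "openin X U" "openin X V" "openin X W" "W \<subseteq> V" "V \<subseteq> U" and t: "t \<in> carrier (sect jets U)"
  from t obtain c where c: "Poly_Mapping.keys c \<subseteq> nbhd_sections U \<times> carrier (sect F U)" "t = jet_class U c"
    by (rule jets_carrierE)
  have WU: "W \<subseteq> U" using U by auto
  have "tensor_hom (\<lambda>a. restrict (restrict a V) W) (\<lambda>s. restr F V W (restr F U V s)) c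
      = tensor_hom (\<lambda>a. restrict a W) (restr F U W) c"
    by (rule tensor_hom_cong[OF c(1)]) (use U in \<open>auto simp: restr_restr fun_eq_iff\<close>)
  then show "restr jets V W (restr jets U V t) = restr jets U W t"
    unfolding c(2) jets_restr[OF U(1,2,5)] jets_restr[OF U(2,3,4)] jets_restr[OF U(1,3) WU]
    by (simp add: tensor_hom_tensor_hom)
qed

end

section \<open>The skyscraper sheaf\<close>

lemma skyscraper_simps [simp]:
  "carrier (sect (skyscraper p) U) = {c. p \<notin> U \<longrightarrow> c = 0}"
  "add (sect (skyscraper p) U) = (+)"
  "ring.zero (sect (skyscraper p) U) = 0"
  "f \<odot>\<^bsub>sect (skyscraper p) U\<^esub> c = (if p \<in> U then f p * c else 0)"
  "restr (skyscraper p) U V c = (if p \<in> V then c else 0)"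
  by (simp_all add: skyscraper_def)

lemma comm_group_skyscraper: "comm_group (add_monoid (sect (skyscraper p) U))"
proof (rule comm_groupI, goal_cases)
  case (6 c)
  then show ?case by (intro bexI[of _ "- c"]) auto
qed auto

text \<open>\<open>tensor_induced\<close> forms integer multiples and finite sums inside the module
  of sections. Together with \<open>skyscraper_finsum\<close> this turns them into complex
  arithmetic, comparable with \<open>frag_sum\<close>.\<close>

lemma skyscraper_add_pow:
  fixes n :: int
  assumes c: "c \<in> carrier (sect (skyscraper p) U)"
  shows "[n] \<cdot>\<^bsub>sect (skyscraper p) U\<^esub> c = of_int n * c"
proof -
  let ?G = "add_monoid (sect (skyscraper p) U)"
  interpret comm_group ?G by (rule comm_group_skyscraper)
  have nat: "c [^]\<^bsub>?G\<^esub> k = of_nat k * c" for k :: nat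
    by (induction k) (simp_all add: algebra_simps)
  have "c [^]\<^bsub>?G\<^esub> n = of_int n * c"
  proof (cases n)
    case (nonneg k)
    show ?thesis unfolding nonneg int_pow_int nat by simp
  next
    case (neg k)
    have "c [^]\<^bsub>?G\<^esub> (- int (Suc k)) = inv\<^bsub>?G\<^esub> (of_nat (Suc k) * c)"
      using int_pow_neg_int[of c "Suc k"] c nat[of "Suc k"] by simp
    also have "\<dots> = - (of_nat (Suc k) * c)"
      by (rule inv_equality) (use c in auto)
    finally show ?thesis by (simp add: neg algebra_simps)
  qed
  then show ?thesis by (simp add: add_pow_def)
qed

lemma skyscraper_finsum:
  assumes "finite K" "g \<in> K \<rightarrow> carrier (sect (skyscraper p) U)"
  shows "finsum (sect (skyscraper p) U) g K = sum g K"
proof -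
  interpret comm_group "add_monoid (sect (skyscraper p) U)" by (rule comm_group_skyscraper)
  show ?thesis using assms
  proof (induction K)
    case (insert k K)
    then have "g \<in> K \<rightarrow> carrier (add_monoid (sect (skyscraper p) U))"
      "g k \<in> carrier (add_monoid (sect (skyscraper p) U))" by auto
    with insert finprod_insert[OF insert(1,2) this] show ?case by (simp add: finsum_def)
  next
    case empty
    show ?case unfolding finsum_def finprod_empty by simp
  qed
qed

section \<open>Evaluation and derivative on jets of the skyscraper\<close>

locale skyscraper_jets = chart_point X A U0 \<phi> i p
  for X :: "'a topology" and A :: "('a, 'n::finite) chart set" and U0 \<phi> i p
begin

sublocale S: presheaf_of_modules X A "skyscraper p"
  by unfold_locales (auto simp: module_closed_def algebra_simps)

abbreviation "J \<equiv> jet_presheaf X A (skyscraper p)"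

abbreviation ev :: "('a \<times> 'a \<Rightarrow> complex) \<Rightarrow> complex" where "ev \<equiv> \<lambda>h. h (diag p)"

text \<open>The functional that \<open>l\<close> induces on jets of the skyscraper:
  \<open>a \<otimes> c\<close> goes to the value of \<open>l\<close> at the germ of \<open>a\<close>
  at \<open>p\<close>, times \<open>c\<close>. It is defined on formal sums, that is, on
  representatives of tensors.\<close>

definition jet_value :: "(('a \<times> 'a \<Rightarrow> complex) \<Rightarrow> complex) \<Rightarrow> ('a jet_fun \<times> complex \<Rightarrow>\<^sub>0 int) \<Rightarrow> complex" where
  "jet_value l = frag_sum (\<lambda>(a, c). germ_value l (a p) * c)"

text \<open>Linearity for the module structure given by the second projection makes a functional
  descend to the tensor product with the skyscraper.\<close>

definition fibre_functional :: "(('a \<times> 'a \<Rightarrow> complex) \<Rightarrow> complex) \<Rightarrow> bool" where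
  "fibre_functional l \<longleftrightarrow> jet_functional p l \<and>
     (\<forall>U f a. openin X U \<longrightarrow> p \<in> U \<longrightarrow> f \<in> carrier (hol_ring A U) \<longrightarrow> a \<in> nbhd_sections U \<longrightarrow>
        germ_value l ((f \<odot>\<^bsub>nbhd_module X A U\<^esub> a) p) = f p * germ_value l (a p))"

text \<open>Along \<open>(curve t, p)\<close> a function of the second coordinate is constant, while
  a function of the first is followed along the curve.\<close>

lemma jet_deriv_pullback:
  assumes "openin X U" "p \<in> U"
  shows "\<delta> (\<lambda>z\<in>U \<times> U. f (snd z)) = 0" "\<delta> (\<lambda>z\<in>U \<times> U. f (fst z)) = deriv (\<lambda>t. f (curve t)) 0"
proof -
  have d: "diag p \<in> U \<times> U" using assms by (simp add: diag_def)
  have "\<delta> (\<lambda>z\<in>U \<times> U. f (snd z)) = \<delta> (\<lambda>z. f (snd z))"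
    by (rule jet_deriv_cong[OF openin_square[OF assms(1)] d]) simp
  then show "\<delta> (\<lambda>z\<in>U \<times> U. f (snd z)) = 0" by (simp add: jet_deriv_def)
  have "\<delta> (\<lambda>z\<in>U \<times> U. f (fst z)) = \<delta> (\<lambda>z. f (fst z))"
    by (rule jet_deriv_cong[OF openin_square[OF assms(1)] d]) simp
  then show "\<delta> (\<lambda>z\<in>U \<times> U. f (fst z)) = deriv (\<lambda>t. f (curve t)) 0" by (simp add: jet_deriv_def)
qed

text \<open>The Leibniz rule on germs, for both projections at once. Its last term vanishes for
  \<open>snd\<close>, which gives balance, and survives for \<open>fst\<close>, which gives the
  contradiction.\<close>

lemma germ_value_pullback_mult:
  assumes U: "openin X U" "p \<in> U" and pr: "pr = fst \<or> pr = snd"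
    and f: "f \<in> carrier (hol_ring A U)" and a: "a \<in> nbhd_sections U"
  shows "germ_value ev ((nbhd_pullback X A pr U f \<otimes>\<^bsub>sect (nbhd_sheaf X A) U\<^esub> a) p) = f p * germ_value ev (a p)"
    "germ_value \<delta> ((nbhd_pullback X A pr U f \<otimes>\<^bsub>sect (nbhd_sheaf X A) U\<^esub> a) p) =
      f p * germ_value \<delta> (a p) + \<delta> (\<lambda>z\<in>U \<times> U. f (pr z)) * germ_value ev (a p)"
proof -
  let ?b = "nbhd_pullback X A pr U f"
  note lf = jet_functional_eval[of p] jet_functional_deriv
  obtain W h k where W: "openin XX W" "diag p \<in> W" "h \<in> carrier (hol_ring AA W)" "k \<in> carrier (hol_ring AA W)"
    and rep: "\<forall>l. jet_functional p l \<longrightarrow> germ_value l (?b p) = l h \<and> germ_value l (a p) = l k \<and>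
      germ_value l ((?b \<otimes>\<^bsub>sect (nbhd_sheaf X A) U\<^esub> a) p) = l (\<lambda>x\<in>W. h x * k x)"
    by (rule nbhd_mult_representatives[OF nbhd_pullback_closed[OF U(1) pr f] a U(2)])
  note h = rep[rule_format, THEN conjunct1] and k = rep[rule_format, THEN conjunct2, THEN conjunct1]
    and hk = rep[rule_format, THEN conjunct2, THEN conjunct2]
  have l: "l h = l (\<lambda>z\<in>U \<times> U. f (pr z))" if "jet_functional p l" for l
    using h[OF that] germ_value_pullback[OF that U pr f] by simp
  have evh: "h (diag p) = f p" using l[OF lf(1)] U(2) pr by (auto simp: diag_def)
  have "germ_value ev ((?b \<otimes>\<^bsub>sect (nbhd_sheaf X A) U\<^esub> a) p) = h (diag p) * k (diag p)"
    unfolding hk[OF lf(1)] using W(2) by simp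
  then show "germ_value ev ((?b \<otimes>\<^bsub>sect (nbhd_sheaf X A) U\<^esub> a) p) = f p * germ_value ev (a p)"
    unfolding k[OF lf(1)] evh .
  have "germ_value \<delta> ((?b \<otimes>\<^bsub>sect (nbhd_sheaf X A) U\<^esub> a) p) = h (diag p) * \<delta> k + \<delta> h * k (diag p)"
    unfolding hk[OF lf(2)] by (rule jet_deriv_mult[OF W])
  then show "germ_value \<delta> ((?b \<otimes>\<^bsub>sect (nbhd_sheaf X A) U\<^esub> a) p) =
      f p * germ_value \<delta> (a p) + \<delta> (\<lambda>z\<in>U \<times> U. f (pr z)) * germ_value ev (a p)"
    unfolding k[OF lf(1)] k[OF lf(2)] evh l[OF lf(2)] .
qed

lemma fibre_functional_ev: "fibre_functional ev"
  unfolding fibre_functional_def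
  by (simp add: jet_functional_eval nbhd_module_def germ_value_pullback_mult(1) del: nbhd_sheaf_simps(2))

lemma fibre_functional_deriv: "fibre_functional \<delta>"
  unfolding fibre_functional_def
  by (simp add: jet_functional_deriv nbhd_module_def germ_value_pullback_mult(2) jet_deriv_pullback
      del: nbhd_sheaf_simps(2))

text \<open>Biadditivity kills the first two kinds of relation. For the third, a scalar
  \<open>f\<close> acts on the skyscraper by \<open>f p\<close>, and a fibre functional turns its
  action through \<open>snd\<close> into the same factor.\<close>

lemma jet_value_null:
  assumes l: "fibre_functional l" and U: "openin X U" "p \<in> U" and n: "n \<in> S.jet_null U"
  shows "jet_value l n = 0"
proof -
  have "jet_value l n \<in> {0}"
  proof (rule tensor_null_image[OF S.nbhd_module_closed[OF U(1)] S.sect_closed[OF U(1)] _ _ _ _ _ n])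
    fix c assume "c \<in> tensor_relations (hol_ring A U) (nbhd_module X A U) (sect (skyscraper p) U)"
    then show "jet_value l c \<in> {0}"
      unfolding tensor_relations_def
      by (elim UnE CollectE exE conjE)
         (use l U in \<open>simp_all add: jet_value_def frag_sum_diff S.carrier_nbhd_module fibre_functional_def
            germ_value_add distrib_left distrib_right mult.assoc mult.left_commute\<close>)
  qed (simp_all add: jet_value_def frag_sum_add)
  then show ?thesis by simp
qed

lemma jet_value_class:
  assumes "fibre_functional l" "openin X U" "p \<in> U" "b \<in> S.jet_class U c"
  shows "jet_value l b = jet_value l c"
  using assms(4) jet_value_null[OF assms(1-3)] by (auto simp: frag_coset jet_value_def frag_sum_add)

lemma jet_value_section:
  assumes "fibre_functional l" "openin X U" "p \<in> U" "t \<in> carrier (sect J U)" "b \<in> t" "c \<in> t"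
  shows "jet_value l b = jet_value l c"
  using assms(4-6) jet_value_class[OF assms(1-3)] by (metis S.jets_carrierE)

text \<open>As long as \<open>p\<close> stays in the smaller set, restriction changes neither the
  germ of \<open>a\<close> at \<open>p\<close> nor the skyscraper component.\<close>

lemma jet_value_restr:
  assumes l: "fibre_functional l" and U: "openin X U" "openin X V" "V \<subseteq> U" "p \<in> V"
    and b: "b \<in> restr J U V T"
  obtains c where "c \<in> T" "jet_value l b = jet_value l c"
proof -
  from b obtain c where c: "c \<in> T"
    "b \<in> S.jet_class V (tensor_hom (restr (nbhd_sheaf X A) U V) (restr (skyscraper p) U V) c)"
    by (auto simp: jet_presheaf_def tensor_map_def S.carrier_nbhd_module)
  have "jet_value l b = jet_value l (tensor_hom (restr (nbhd_sheaf X A) U V) (restr (skyscraper p) U V) c)"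
    by (rule jet_value_class[OF l U(2,4) c(2)])
  also have "\<dots> = jet_value l c"
    using U(4) by (simp add: jet_value_def frag_sum_tensor_hom)
  finally show thesis using that[OF c(1)] by simp
qed

lemma jets_nonempty: "t \<in> carrier (sect J U) \<Longrightarrow> t \<noteq> {}"
  using tensor_class_self by (metis S.jets_carrierE empty_iff)

text \<open>Both representatives are compared through a formal sum representing their common
  restriction near \<open>p\<close>.\<close>

lemma jet_value_germ:
  assumes l: "fibre_functional l" and U: "openin X U" "p \<in> U" "t \<in> carrier (sect J U)"
    and V: "(V, t') \<in> germ X J p U t" and bc: "b \<in> t" "c \<in> t'"
  shows "jet_value l b = jet_value l c"
  using V
proof (rule S.jets.germ_memD)
  fix W assume V: "openin X V" "p \<in> V" "t' \<in> carrier (sect J V)"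
    and W: "openin X W" "p \<in> W" "W \<subseteq> U" "W \<subseteq> V" and eq: "restr J U W t = restr J V W t'"
  have "restr J U W t \<noteq> {}" by (rule jets_nonempty[OF S.jets.restr_closed[OF U(1) W(1,3) U(3)]])
  then obtain d where d: "d \<in> restr J U W t" by blast
  obtain b' where b': "b' \<in> t" "jet_value l d = jet_value l b'"
    using jet_value_restr[OF l U(1) W(1,3,2) d] by blast
  obtain c' where c': "c' \<in> t'" "jet_value l d = jet_value l c'"
    using jet_value_restr[OF l V(1) W(1,4,2)] d eq by metis
  show ?thesis
    using jet_value_section[OF l U bc(1) b'(1)] jet_value_section[OF l V bc(2) c'(1)] b' c' by simp
qed

text \<open>The presheaf map behind \<pi> multiplies \<open>c\<close> by the restriction of
  \<open>a\<close> to the diagonal. The skyscraper sees this restriction only at \<open>p\<close>,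
  where it is evaluation of the germ; over sets missing \<open>p\<close> all is zero.\<close>

lemma tensor_induced_skyscraper:
  assumes V: "openin X V" and q: "q \<in> carrier (sect J V)" and c: "c \<in> q"
  shows "tensor_induced (sect (skyscraper p) V) (\<lambda>a s. nbhd_restrict V a \<odot>\<^bsub>sect (skyscraper p) V\<^esub> s) q =
    (if p \<in> V then jet_value ev c else 0)"
proof -
  let ?\<beta> = "\<lambda>k. nbhd_restrict V (fst k) \<odot>\<^bsub>sect (skyscraper p) V\<^esub> snd k"
  have "(\<Oplus>\<^bsub>sect (skyscraper p) V\<^esub>k\<in>Poly_Mapping.keys b. [Poly_Mapping.lookup b k] \<cdot>\<^bsub>sect (skyscraper p) V\<^esub> ?\<beta> k)
      = (if p \<in> V then jet_value ev c else 0)" if b: "b \<in> q" for b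
  proof -
    have add_pow: "[n] \<cdot>\<^bsub>sect (skyscraper p) V\<^esub> ?\<beta> k = of_int n * ?\<beta> k" for n :: int and k
      by (rule skyscraper_add_pow) simp
    have "(\<Oplus>\<^bsub>sect (skyscraper p) V\<^esub>k\<in>Poly_Mapping.keys b. [Poly_Mapping.lookup b k] \<cdot>\<^bsub>sect (skyscraper p) V\<^esub> ?\<beta> k)
        = (\<Sum>k\<in>Poly_Mapping.keys b. of_int (Poly_Mapping.lookup b k) * ?\<beta> k)"
      unfolding add_pow by (rule skyscraper_finsum) auto
    also have "\<dots> = (if p \<in> V then jet_value ev b else 0)"
      by (simp add: jet_value_def frag_sum_def nbhd_restrict_eq case_prod_unfold)
    also have "\<dots> = (if p \<in> V then jet_value ev c else 0)"
      using jet_value_section[OF fibre_functional_ev V _ q b c] by simp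
    finally show ?thesis .
  qed
  with c have "(\<lambda>b. \<Oplus>\<^bsub>sect (skyscraper p) V\<^esub>k\<in>Poly_Mapping.keys b.
      [Poly_Mapping.lookup b k] \<cdot>\<^bsub>sect (skyscraper p) V\<^esub> ?\<beta> k) ` q = {if p \<in> V then jet_value ev c else 0}"
    by (auto intro!: image_eqI[of _ _ c])
  then show ?thesis by (simp add: tensor_induced_def case_prod_unfold)
qed

lemma jet_sheaf_carrier:
  "carrier (sect (jet_sheaf X A (skyscraper p)) U) = inverse_image_sections X X id J U"
  by (simp add: jet_sheaf_def sheafify_module_def)

text \<open>Evaluates the definite description in \<open>sheafify_lift\<close>. The germ at
  \<open>p\<close> forces the value, and at other points the local condition can be met on a
  neighbourhood missing \<open>p\<close>.\<close>

lemma jet_proj_skyscraper: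
  assumes Hausdorff: "Hausdorff_space X" and U: "p \<in> U"
    and s: "s \<in> carrier (sect (jet_sheaf X A (skyscraper p)) U)"
  obtains V q where "openin X V" "p \<in> V" "q \<in> carrier (sect J V)" "s p = germ X J p V q"
    "\<And>c. c \<in> q \<Longrightarrow> jet_proj X A (skyscraper p) U s = jet_value ev c"
proof -
  let ?h = "\<lambda>V. tensor_induced (sect (skyscraper p) V) (\<lambda>a s. nbhd_restrict V a \<odot>\<^bsub>sect (skyscraper p) V\<^esub> s)"
  \<comment> \<open>Sections of a sheafification are witnessed on some possibly larger
    \<open>W\<close>, whereas \<open>sheafify_lift\<close> asks for a witness on \<open>V\<close>
    itself; hence the restriction.\<close>
  have local: "\<exists>V q. openin X V \<and> x \<in> V \<and> V \<subseteq> U \<and> q \<in> carrier (sect J V) \<and> (\<forall>y\<in>V. s y = germ X J y V q)"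
    if "x \<in> U" for x
  proof -
    from s that obtain V W q where *: "openin X V" "x \<in> V" "V \<subseteq> U" "openin X W" "V \<subseteq> W"
      "q \<in> carrier (sect J W)" "\<forall>y\<in>V. s y = germ X J y W q"
      unfolding jet_sheaf_carrier inverse_image_sections_def by auto
    then show ?thesis
      by (intro exI[of _ V] exI[of _ "restr J W V q"]) (simp add: S.jets.germ_restr S.jets.restr_closed)
  qed
  from local[OF U] obtain V q where V: "openin X V" "p \<in> V" "V \<subseteq> U" "q \<in> carrier (sect J V)"
    "\<forall>y\<in>V. s y = germ X J y V q" by blast
  from jets_nonempty[OF V(4)] obtain c where c: "c \<in> q" by blast
  have hq: "?h V q = jet_value ev c" using tensor_induced_skyscraper[OF V(1,4) c] V(2) by simp
  have "jet_proj X A (skyscraper p) U s = jet_value ev c"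
    unfolding jet_proj_def sheafify_lift_def
  proof (rule the_equality)
    have "\<exists>V' q'. openin X V' \<and> x \<in> V' \<and> V' \<subseteq> U \<and> q' \<in> carrier (sect J V') \<and>
        (\<forall>y\<in>V'. s y = germ X J y V' q') \<and> restr (skyscraper p) U V' (jet_value ev c) = ?h V' q'"
      if x: "x \<in> U" for x
    proof (cases "x = p")
      case True
      with V hq show ?thesis by (intro exI[of _ V] exI[of _ q]) simp
    next
      case False
      from local[OF x] obtain V1 q1 where V1: "openin X V1" "x \<in> V1" "V1 \<subseteq> U" "q1 \<in> carrier (sect J V1)"
        "\<forall>y\<in>V1. s y = germ X J y V1 q1" by blast
      \<comment> \<open>Removing the closed point \<open>p\<close> leaves an open neighbourhood of
        \<open>x\<close> over which the skyscraper is zero, so the required equation reads 0 =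
        0.\<close>
      let ?V = "V1 - {p}" and ?q = "restr J V1 (V1 - {p}) q1"
      have "p \<in> topspace X" using V openin_subset by blast
      then have o: "openin X ?V" using closedin_Hausdorff_singleton[OF Hausdorff] V1(1) by blast
      have q: "?q \<in> carrier (sect J ?V)" using S.jets.restr_closed[OF V1(1) o _ V1(4)] by blast
      then obtain d where "d \<in> ?q" using jets_nonempty by blast
      from tensor_induced_skyscraper[OF o q this] have "?h ?V ?q = 0" by simp
      moreover have "\<forall>y\<in>?V. s y = germ X J y ?V ?q"
        using V1 o by (simp add: S.jets.germ_restr)
      ultimately show ?thesis
        using V1 o q False by (intro exI[of _ ?V] exI[of _ ?q]) auto
    qed
    then show "jet_value ev c \<in> carrier (sect (skyscraper p) U) \<and> (\<forall>x\<in>U. \<exists>V' q'. openin X V' \<and> x \<in> V' \<and>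
        V' \<subseteq> U \<and> q' \<in> carrier (sect J V') \<and> (\<forall>y\<in>V'. s y = germ X J y V' q') \<and>
        restr (skyscraper p) U V' (jet_value ev c) = ?h V' q')" using U by simp
  next
    fix t assume "t \<in> carrier (sect (skyscraper p) U) \<and> (\<forall>x\<in>U. \<exists>V' q'. openin X V' \<and> x \<in> V' \<and>
        V' \<subseteq> U \<and> q' \<in> carrier (sect J V') \<and> (\<forall>y\<in>V'. s y = germ X J y V' q') \<and>
        restr (skyscraper p) U V' t = ?h V' q')"
    then obtain V' q' where V': "openin X V'" "p \<in> V'" "q' \<in> carrier (sect J V')"
      "\<forall>y\<in>V'. s y = germ X J y V' q'" "restr (skyscraper p) U V' t = ?h V' q'"
      using U by meson
    from jets_nonempty[OF V'(3)] obtain c' where c': "c' \<in> q'" by blast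
    have "t = jet_value ev c'"
      using V'(2,5) tensor_induced_skyscraper[OF V'(1,3) c'] by simp
    \<comment> \<open>Both \<open>q\<close> and \<open>q'\<close> represent the germ
      \<open>s p\<close>, so evaluation cannot tell them apart.\<close>
    moreover have "(V', q') \<in> germ X J p V q"
      using S.jets.germ_self[OF V'(1-3)] V V' by auto
    ultimately show "t = jet_value ev c"
      using jet_value_germ[OF fibre_functional_ev V(1,2,4) _ c c'] by simp
  qed
  moreover have "jet_value ev d = jet_value ev c" if "d \<in> q" for d
    using jet_value_section[OF fibre_functional_ev V(1,2,4) that c] .
  ultimately show thesis using V by (intro that[of V q]) auto
qed

text \<open>Since \<open>f p = 0\<close>, the Leibniz rule leaves only the derivative of
  \<open>f\<close> times the evaluation. The hypothesis on \<open>stalk_smult\<close> is a mere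
  membership, so it is enough to follow the one product of representatives that produced
  \<open>(W, q)\<close>.\<close>

lemma jet_value_smult:
  assumes U: "openin X U" "p \<in> U" and f: "f \<in> carrier (hol_ring A U)" "f p = 0"
    and V0: "openin X V0" "p \<in> V0" "q0 \<in> carrier (sect J V0)" "c0 \<in> q0"
    and W: "openin X W" "p \<in> W" "q \<in> carrier (sect J W)" "c \<in> q"
    and mem: "(W, q) \<in> stalk_smult X (hol_sheaf A) J p U f (germ X J p V0 q0)"
  shows "jet_value \<delta> c = deriv (\<lambda>t. f (curve t)) 0 * jet_value ev c0"
proof -
  note l = fibre_functional_ev fibre_functional_deriv
  from mem obtain V t where t: "(V, t) \<in> germ X J p V0 q0" "V \<subseteq> U"
    "(W, q) \<in> germ X J p V (restrict f V \<odot>\<^bsub>sect J V\<^esub> t)"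
    by (auto simp: stalk_smult_def hol_sheaf_def)
  have V: "openin X V" "p \<in> V" "t \<in> carrier (sect J V)" using t(1) by (auto simp: germ_def)
  have fV: "restrict f V \<in> carrier (hol_ring A V)"
    using hol_ring_restrict[OF open_charts V(1) t(2) f(1)] .
  let ?m = "\<lambda>a. nbhd_pullback X A fst V (restrict f V) \<otimes>\<^bsub>sect (nbhd_sheaf X A) V\<^esub> a"
  from t(3) obtain W' where W': "openin X W'" "p \<in> W'" "W' \<subseteq> V" "W' \<subseteq> W"
    "restr J V W' (restrict f V \<odot>\<^bsub>sect J V\<^esub> t) = restr J W W' q"
    unfolding germ_def by auto
  have "restr J W W' q \<noteq> {}" by (rule jets_nonempty[OF S.jets.restr_closed[OF W(1) W'(1,4) W(3)]])
  then obtain e where e: "e \<in> restr J W W' q" by blast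
  obtain c' where c': "c' \<in> q" "jet_value \<delta> e = jet_value \<delta> c'"
    using jet_value_restr[OF l(2) W(1) W'(1,4,2) e] by blast
  obtain d where d: "d \<in> restrict f V \<odot>\<^bsub>sect J V\<^esub> t" "jet_value \<delta> e = jet_value \<delta> d"
    using jet_value_restr[OF l(2) V(1) W'(1,3,2)] e W'(5) by metis
  \<comment> \<open>Scalars act on jets through \<open>fst\<close> on the first tensor factor and
    trivially on the second, hence \<open>?m\<close> and \<open>id\<close>.\<close>
  from d(1) obtain b where b: "b \<in> t" "d \<in> S.jet_class V (tensor_hom ?m id b)"
    unfolding jet_presheaf_def by (auto simp: Let_def tensor_map_def S.carrier_nbhd_module simp del: nbhd_sheaf_simps(2))
  have keys: "Poly_Mapping.keys b \<subseteq> nbhd_sections V \<times> carrier (sect (skyscraper p) V)"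
    by (rule S.keys_jets[OF V(1,3) b(1)])
  let ?D = "deriv (\<lambda>t. f (curve t)) 0"
  have "\<delta> (\<lambda>z\<in>V \<times> V. restrict f V (fst z)) = \<delta> (\<lambda>z\<in>V \<times> V. f (fst z))"
    by (rule arg_cong[of _ _ \<delta>]) auto
  then have D: "\<delta> (\<lambda>z\<in>V \<times> V. restrict f V (fst z)) = ?D"
    using jet_deriv_pullback(2)[OF V(1,2)] by simp
  \<comment> \<open>The term with the unknown derivative of \<open>a\<close> carries the factor
    \<open>f p\<close> and disappears.\<close>
  have m: "germ_value \<delta> (?m a p) = ?D * germ_value ev (a p)" if "a \<in> nbhd_sections V" for a
    using germ_value_pullback_mult(2)[OF V(1,2) _ fV that, of fst] f(2) V(2) D by simp
  have "jet_value \<delta> c = jet_value \<delta> c'" by (rule jet_value_section[OF l(2) W(1,2,3,4) c'(1)])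
  also have "\<dots> = jet_value \<delta> d" using c' d by simp
  also have "\<dots> = jet_value \<delta> (tensor_hom ?m id b)" by (rule jet_value_class[OF l(2) V(1,2) b(2)])
  also have "\<dots> = (\<Sum>k\<in>Poly_Mapping.keys b. of_int (Poly_Mapping.lookup b k) * (germ_value \<delta> (?m (fst k) p) * snd k))"
    unfolding jet_value_def frag_sum_tensor_hom unfolding frag_sum_def
    by (simp add: case_prod_unfold del: nbhd_sheaf_simps(2))
  also have "\<dots> = (\<Sum>k\<in>Poly_Mapping.keys b. ?D * (of_int (Poly_Mapping.lookup b k) * (germ_value ev (fst k p) * snd k)))"
    by (rule sum.cong[OF refl]) (use keys in \<open>auto simp: m simp del: nbhd_sheaf_simps(2)\<close>)
  also have "\<dots> = ?D * jet_value ev b"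
    by (simp add: jet_value_def frag_sum_def case_prod_unfold sum_distrib_left)
  also have "jet_value ev b = jet_value ev c0"
    by (rule jet_value_germ[OF l(1) V0(1-3) t(1) V0(4) b(1), symmetric])
  finally show ?thesis .
qed

end

section \<open>Multiplying the jet of 1 by functions that vanish at the point\<close>

theorem proposition13:
  fixes X :: "'a topology" and A :: "('a, 'n::finite) chart set" and p :: 'a
  assumes "complex_manifold X A" and "p \<in> topspace X"
  shows "\<not> (\<exists>D. holomorphic_connection X A (skyscraper p) D)"
proof
  assume "\<exists>D. holomorphic_connection X A (skyscraper p) D"
  then obtain D where hom: "module_presheaf_hom X (hol_sheaf A) (skyscraper p) (jet_sheaf X A (skyscraper p)) D"
    and proj: "\<And>U s. openin X U \<Longrightarrow> s \<in> carrier (sect (skyscraper p) U) \<Longrightarrow> jet_proj X A (skyscraper p) U (D U s) = s"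
    unfolding holomorphic_connection_def by blast
  from assms(1) have Hausdorff: "Hausdorff_space X" and atlas: "complex_atlas X A"
    unfolding complex_manifold_def by auto
  from atlas assms(2) obtain U \<phi> where U: "(U, \<phi>) \<in> A" "p \<in> U" "openin X U"
    unfolding complex_atlas_def by fast
  note charts = complex_atlas_open_charts[OF atlas]
  \<comment> \<open>Any coordinate direction will do; one exists because the type \<open>'n\<close>
    is inhabited, so the dimension is positive.\<close>
  fix i :: 'n
  interpret skyscraper_jets X A U \<phi> i p
    by unfold_locales (use charts U in auto)
  \<comment> \<open>The shift makes \<open>f\<close> vanish at \<open>p\<close>, and along
    \<open>curve\<close> it equals the parameter, so its derivative there is 1. Adding the negated
    constant matches the closure rule for sums.\<close>
  define f where "f = (\<lambda>x\<in>U. \<phi> x $ i + - (\<phi> p $ i))"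
  have f: "f \<in> carrier (hol_ring A U)"
  proof (rule hol_ring_carrier_congI[OF charts U(3)])
    fix V \<psi> assume V: "(V, \<psi>) \<in> A"
    have "holomorphic_many (\<lambda>z. \<phi> (inv_into V \<psi> z) $ i) (\<psi> ` (U \<inter> V))"
      using atlas V U(1) unfolding complex_atlas_def by (fastforce simp: Int_commute)
    then show "holomorphic_many (\<lambda>z. \<phi> (inv_into V \<psi> z) $ i + - (\<phi> p $ i)) (\<psi> ` (U \<inter> V))"
      by (intro holomorphic_many_add holomorphic_many_const)
  qed (auto simp: f_def)
  \<comment> \<open>The zero function serves as a second multiplier: it also vanishes at
    \<open>p\<close>, but with derivative 0. Comparing the two replaces an identification of
    \<open>D U 0\<close> with the zero jet.\<close>
  have z: "(\<lambda>x\<in>U. 0) \<in> carrier (hol_ring A U)" by (rule hol_ring_const_closed[OF charts U(3)])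
  have "\<forall>\<^sub>F t in nhds 0. f (curve t) = t"
    using eventually_curve[OF U(3,2)] by (rule eventually_mono) (auto simp: f_def)
  then have df: "deriv (\<lambda>t. f (curve t)) 0 = 1"
    using deriv_cong_ev[of "\<lambda>t. f (curve t)" "\<lambda>t. t" 0 0] by simp
  have "\<forall>\<^sub>F t in nhds 0. (\<lambda>x\<in>U. 0) (curve t) = (0 :: complex)"
    using eventually_curve[OF U(3,2)] by (rule eventually_mono) auto
  then have dz: "deriv (\<lambda>t. (\<lambda>x\<in>U. 0 :: complex) (curve t)) 0 = 0"
    using deriv_cong_ev[of "\<lambda>t. (\<lambda>x\<in>U. 0) (curve t)" "\<lambda>t. 0" 0 0] by simp
  have lin: "D U 1 \<in> carrier (sect (jet_sheaf X A (skyscraper p)) U)"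
    "D U 0 \<in> carrier (sect (jet_sheaf X A (skyscraper p)) U)"
    "g \<in> carrier (hol_ring A U) \<Longrightarrow> g p = 0 \<Longrightarrow> D U 0 = g \<odot>\<^bsub>sect (jet_sheaf X A (skyscraper p)) U\<^esub> D U 1" for g
  proof -
    from hom U(3) have *: "D U \<in> linear_maps (sect (hol_sheaf A) U) (sect (skyscraper p) U) (sect (jet_sheaf X A (skyscraper p)) U)"
      unfolding module_presheaf_hom_def by blast
    then show "D U 1 \<in> carrier (sect (jet_sheaf X A (skyscraper p)) U)"
      "D U 0 \<in> carrier (sect (jet_sheaf X A (skyscraper p)) U)"
      using U(2) unfolding linear_maps_def by auto
    assume g: "g \<in> carrier (hol_ring A U)" "g p = 0"
    \<comment> \<open>The product with 1 is kept unevaluated so that linearity of \<open>D\<close>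
      applies; only afterwards does it simplify to \<open>g p\<close>, which is 0.\<close>
    have "D U (g \<odot>\<^bsub>sect (skyscraper p) U\<^esub> 1) = g \<odot>\<^bsub>sect (jet_sheaf X A (skyscraper p)) U\<^esub> D U 1"
      using * g(1) U(2) unfolding linear_maps_def hol_sheaf_def by (simp del: skyscraper_simps(4))
    with g(2) U(2) show "D U 0 = g \<odot>\<^bsub>sect (jet_sheaf X A (skyscraper p)) U\<^esub> D U 1" by simp
  qed
  obtain V q where V: "openin X V" "p \<in> V" "q \<in> carrier (sect J V)" "D U 1 p = germ X J p V q"
    and ev_q: "\<And>c. c \<in> q \<Longrightarrow> jet_proj X A (skyscraper p) U (D U 1) = jet_value ev c"
    using jet_proj_skyscraper[OF Hausdorff U(2) lin(1)] by metis
  obtain W r where W: "openin X W" "p \<in> W" "r \<in> carrier (sect J W)" "D U 0 p = germ X J p W r"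
    using jet_proj_skyscraper[OF Hausdorff U(2) lin(2)] by metis
  from jets_nonempty[OF V(3)] jets_nonempty[OF W(3)] obtain b c where bc: "b \<in> q" "c \<in> r" by blast
  \<comment> \<open>The left side does not mention \<open>g\<close>. Taking \<open>g\<close> to be
    \<open>f\<close> and then the zero function equates \<open>jet_value ev b\<close> with
    0.\<close>
  have "jet_value \<delta> c = deriv (\<lambda>t. g (curve t)) 0 * jet_value ev b"
    if g: "g \<in> carrier (hol_ring A U)" "g p = 0" for g
  proof (rule jet_value_smult[OF U(3,2) g V(1-3) bc(1) W(1-3) bc(2)])
    have "D U 0 p = stalk_smult X (hol_sheaf A) J p U g (D U 1 p)"
      using lin(3)[OF g] U(2) by (simp add: jet_sheaf_def sheafify_module_def)
    then show "(W, r) \<in> stalk_smult X (hol_sheaf A) J p U g (germ X J p V q)"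
      using S.jets.germ_self[OF W(1-3)] V(4) W(4) by simp
  qed
  from this[OF f] this[OF z] have "jet_value ev b = 0"
    using U(2) df dz by (simp add: f_def)
  moreover have "jet_value ev b = 1"
    using ev_q[OF bc(1)] proj[OF U(3), of 1] U(2) by simp
  ultimately show False by simp
qed

end
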